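(* Let $F \subset \mathbb{R}^d$ be a self-conformal set containing at least two points. Then $F$ satisfies the weak separation condition if and only if it satisfies the identity limit criterion.
   Context: Conformal maps and self-conformal sets: let $\Omega \subset \mathbb{R}^d$ be open. A $C^1$-mapping $\varphi \colon \Omega \to \mathbb{R}^d$ is conformal if for every $x\in\Omega$ the differential $\varphi'(x)$ is a similarity, i.e. $|\varphi'(x)y| = |\varphi'(x)||y| \ne 0$ for all $y \in \mathbb{R}^d \setminus \{0\}$ (where $|\varphi'(x)|$ is the operator norm), and $x \mapsto \varphi'(x)$ is Hölder continuous: there exist $\alpha,c>0$ with $|\varphi'(x) - \varphi'(y)| \le c|x-y|^\alpha$ for all $x,y \in \Omega$. (For $d=1$ these are the $C^{1+\alpha}$-functions with non-vanishing derivative.) A finite family $\{\varphi_i\}_{i=1}^N$, $N \ge 2$, is a conformal iterated function system if each $\varphi_i$ is an injective conformal mapping on a common non-empty bounded open convex set $\Omega \subset \mathbb{R}^d$ such that $\overline{\varphi_i(\Omega)} \subset \Omega$ and $\|\varphi_i'\| := \sup_{x \in \Omega}|\varphi_i'(x)| < 1$. The associated self-conformal set is the unique non-empty compact set $F \subset \Omega$ with $F = \bigcup_{i=1}^N \varphi_i(F)$. A self-conformal set always comes with a fixed conformal iterated function system defining it. Words: $\Sigma_* $ is the set of all finite words (including the empty word $\varnothing$) over $\{1,\dots,N\}$. For $\mathtt{i}=i_1\cdots i_n$, $\varphi_{\mathtt{i}} = \varphi_{i_1}\circ\cdots\circ\varphi_{i_n}$, with $\varphi_\varnothing$ the identity,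 and $\|\varphi_{\mathtt{i}}'\| = \sup_{x\in\Omega}|\varphi_{\mathtt{i}}'(x)|$. For non-empty $\mathtt{i}$, $\mathtt{i}^-$ is the word obtained by deleting the last letter of $\mathtt{i}$. Weak separation condition: $\sup \{\#\Phi(x,r) : x \in F \text{ and } r>0 \} < \infty$, where $\Phi(x,r) = \{ \varphi_{\mathtt{i}}|_F : \operatorname{diam}(\varphi_{\mathtt{i}}(F)) \le r < \operatorname{diam}(\varphi_{\mathtt{i}^-}(F)) \text{ and } \varphi_{\mathtt{i}}(F) \cap B(x,r) \ne \emptyset \}$, a set of maps (so coinciding restrictions are counted once), $\mathtt{i}$ ranging over non-empty finite words and $B(x,r)$ being the closed ball. Identity limit criterion: $\inf\{ \|\varphi_{\mathtt{i}}'\|^{-1} \sup_{x \in F}|\varphi_{\mathtt{i}}(x)-\varphi_{\mathtt{j}}(x)| : \mathtt{i},\mathtt{j} \in \Sigma_* \text{ such that } \varphi_{\mathtt{i}}|_F \ne \varphi_{\mathtt{j}}|_F \} > 0$. *)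

theory Defs
  imports "HOL-Analysis.Analysis"
begin

text \<open>
  A map on \<open>\<Omega>\<close> is represented by a total function whose values outside \<open>\<Omega>\<close> are irrelevant: \<open>\<Omega>\<close> is
  open, so derivatives \<open>at x\<close> with \<open>x \<in> \<Omega>\<close> depend only on the values on \<open>\<Omega>\<close>. The norm on
  \<open>'a \<Rightarrow>\<^sub>L 'a\<close> is the operator norm.
\<close>

definition conformal_on :: "('a::euclidean_space \<Rightarrow> 'a) \<Rightarrow> 'a set \<Rightarrow> bool" where
  "conformal_on f \<Omega> \<longleftrightarrow>
     (\<exists>D :: 'a \<Rightarrow> 'a \<Rightarrow>\<^sub>L 'a.
        (\<forall>x\<in>\<Omega>. (f has_derivative blinfun_apply (D x)) (at x)) \<and>
        continuous_on \<Omega> D \<and>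
        (\<forall>x\<in>\<Omega>. \<forall>y. y \<noteq> 0 \<longrightarrow>
           norm (blinfun_apply (D x) y) = norm (D x) * norm y \<and> norm (D x) * norm y \<noteq> 0) \<and>
        (\<exists>\<alpha>>0. \<exists>c>0. \<forall>x\<in>\<Omega>. \<forall>y\<in>\<Omega>. norm (D x - D y) \<le> c * norm (x - y) powr \<alpha>))"

text \<open>
  The real supremum below is only used for maps that are differentiable on \<open>\<Omega>\<close> with bounded
  derivative (for a conformal map on a bounded set this follows from Hoelder continuity, and for
  finite compositions from the chain rule), so that it is a genuine supremum.
\<close>

definition deriv_sup_norm :: "'a::euclidean_space set \<Rightarrow> ('a \<Rightarrow> 'a) \<Rightarrow> real" where
  "deriv_sup_norm \<Omega> f = (SUP x\<in>\<Omega>. onorm (frechet_derivative f (at x)))"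

definition conformal_ifs ::
    "nat \<Rightarrow> (nat \<Rightarrow> 'a::euclidean_space \<Rightarrow> 'a) \<Rightarrow> 'a set \<Rightarrow> bool" where
  "conformal_ifs N \<phi> \<Omega> \<longleftrightarrow>
     N \<ge> 2 \<and> \<Omega> \<noteq> {} \<and> bounded \<Omega> \<and> open \<Omega> \<and> convex \<Omega> \<and>
     (\<forall>i\<in>{1..N}. conformal_on (\<phi> i) \<Omega> \<and> inj_on (\<phi> i) \<Omega> \<and>
        closure (\<phi> i ` \<Omega>) \<subseteq> \<Omega> \<and> deriv_sup_norm \<Omega> (\<phi> i) < 1)"

text \<open>
  For a conformal iterated function system the set \<open>F\<close> is uniquely determined by the following
  conditions (Hutchinson's theorem), so uniqueness is not part of the definition.
\<close>

definition self_conformal_set ::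
    "nat \<Rightarrow> (nat \<Rightarrow> 'a::euclidean_space \<Rightarrow> 'a) \<Rightarrow> 'a set \<Rightarrow> 'a set \<Rightarrow> bool" where
  "self_conformal_set N \<phi> \<Omega> F \<longleftrightarrow>
     conformal_ifs N \<phi> \<Omega> \<and>
     F \<noteq> {} \<and> compact F \<and> F \<subseteq> \<Omega> \<and> F = (\<Union>i\<in>{1..N}. \<phi> i ` F)"

abbreviation words :: "nat \<Rightarrow> nat list set" where
  "words N \<equiv> lists {1..N}"

primrec word_map :: "(nat \<Rightarrow> 'a \<Rightarrow> 'a) \<Rightarrow> nat list \<Rightarrow> 'a \<Rightarrow> 'a" where
  "word_map \<phi> [] = id"
| "word_map \<phi> (i # w) = \<phi> i \<circ> word_map \<phi> w"

definition wsc_maps ::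
    "nat \<Rightarrow> (nat \<Rightarrow> 'a::euclidean_space \<Rightarrow> 'a) \<Rightarrow> 'a set \<Rightarrow> 'a \<Rightarrow> real \<Rightarrow> ('a \<Rightarrow> 'a) set" where
  "wsc_maps N \<phi> F x r =
     {restrict (word_map \<phi> w) F | w.
        w \<in> words N \<and> w \<noteq> [] \<and>
        diameter (word_map \<phi> w ` F) \<le> r \<and> r < diameter (word_map \<phi> (butlast w) ` F) \<and>
        word_map \<phi> w ` F \<inter> cball x r \<noteq> {}}"

text \<open>Finiteness is explicit because \<open>card\<close> is \<open>0\<close> on infinite sets.\<close>

definition weak_separation_condition ::
    "nat \<Rightarrow> (nat \<Rightarrow> 'a::euclidean_space \<Rightarrow> 'a) \<Rightarrow> 'a set \<Rightarrow> bool" where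
  "weak_separation_condition N \<phi> F \<longleftrightarrow>
     (\<exists>K::nat. \<forall>x\<in>F. \<forall>r>0. finite (wsc_maps N \<phi> F x r) \<and> card (wsc_maps N \<phi> F x r) \<le> K)"

text \<open>
  The infimum is taken in the extended reals, so that the infimum of the empty set is \<open>\<infinity>\<close>.
\<close>

definition identity_limit_criterion ::
    "nat \<Rightarrow> (nat \<Rightarrow> 'a::euclidean_space \<Rightarrow> 'a) \<Rightarrow> 'a set \<Rightarrow> 'a set \<Rightarrow> bool" where
  "identity_limit_criterion N \<phi> \<Omega> F \<longleftrightarrow>
     Inf {ereal (inverse (deriv_sup_norm \<Omega> (word_map \<phi> v)) *
                 (SUP x\<in>F. norm (word_map \<phi> v x - word_map \<phi> w x))) | v w.
            v \<in> words N \<and> w \<in> words N \<and>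
            restrict (word_map \<phi> v) F \<noteq> restrict (word_map \<phi> w) F} > 0"

end

theory Submission imports Defs begin

text \<open>
  By bounded distortion, the maps of words, rescaled by their derivative norms, are uniformly bounded in
  \<open>C\<^sup>1\<^sup>+\<^sup>\<alpha>\<close>. If the identity limit criterion holds, then distinct maps in \<open>\<Phi>(x,r)\<close> are separated
  by a multiple of \<open>r\<close> in the supremum norm on \<open>F\<close>; as they are uniformly Lipschitz after rescaling, total
  boundedness limits their number.

  Conversely, suppose the criterion fails. If \<open>f\<close> and \<open>g\<close> are relatively close on \<open>F\<close>, then by
  compactness \<open>f - g\<close> restricted to \<open>F\<close> has a small Lipschitz constant relative to \<open>\<parallel>f'\<parallel>\<close>. Hence around
  a maximum of \<open>|f - g|\<close> there is a piece \<open>\<phi>\<^sub>u(F)\<close>, large compared with that maximum, on which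
  \<open>f \<noteq> g\<close> everywhere; so \<open>f \<circ> \<phi>\<^sub>u\<close> and \<open>g \<circ> \<phi>\<^sub>u\<close> are again relatively close and differ at every
  point of \<open>F\<close>. Given a finite family \<open>H\<close> of distinct, mutually close word maps with a member \<open>h\<close>, such
  a pair \<open>f, f'\<close>, chosen close enough depending on \<open>H\<close>, produces the larger family
  \<open>{f \<circ> k | k \<in> H} \<union> {f' \<circ> h}\<close> of the same kind. Arbitrarily large families of this kind contradict
  the weak separation condition.
\<close>

section \<open>Conformal linear maps and compositions along words\<close>

text \<open>\<open>A\<close> scales every length by exactly \<open>norm A\<close>, so a bound on
  \<open>A o\<^sub>L B\<close> can be divided by \<open>norm A\<close> to bound \<open>B\<close>.
  This turns the chain rule into an exact product of derivative norms.\<close>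

lemma norm_compose_conformal:
  fixes A B :: "'a::euclidean_space \<Rightarrow>\<^sub>L 'a"
  assumes "\<And>y. norm (A y) = norm A * norm y"
  shows "norm (A o\<^sub>L B) = norm A * norm B"
proof (rule antisym)
  show "norm A * norm B \<le> norm (A o\<^sub>L B)"
  proof (cases "A = 0")
    case False
    then have "0 < norm A" by simp
    have "norm (B y) \<le> norm (A o\<^sub>L B) / norm A * norm y" for y
      using assms[of "B y"] norm_blinfun[of "A o\<^sub>L B" y] \<open>0 < norm A\<close>
      by (simp add: field_simps)
    then have "norm B \<le> norm (A o\<^sub>L B) / norm A"
      by (intro norm_blinfun_bound) auto
    with \<open>0 < norm A\<close> show ?thesis by (simp add: field_simps)
  qed simp
qed (rule norm_blinfun_compose)

lemma word_map_append: "word_map \<phi> (v @ w) x = word_map \<phi> v (word_map \<phi> w x)"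
  by (induction v) auto

lemma restrict_eq_iff: "restrict f A = restrict g A \<longleftrightarrow> (\<forall>x\<in>A. f x = g x)"
  by (metis restrict_apply' restrict_ext)

section \<open>Standing setting, with constants uniform over the generating maps\<close>

text \<open>The lower bound \<open>m\<close> is asked for only on \<open>F\<close>: derivatives may
  degenerate towards the boundary of \<Omega>, but not on a compact subset. Hence the later
  estimates often take one point in \<open>F\<close> and the other in \<Omega>.\<close>

locale conformal_attractor =
  fixes N :: nat and \<phi> :: "nat \<Rightarrow> 'a::euclidean_space \<Rightarrow> 'a" and \<Omega> F :: "'a set"
    and D :: "nat \<Rightarrow> 'a \<Rightarrow> 'a \<Rightarrow>\<^sub>L 'a" and \<alpha> c m lam :: real
  assumes bounded_dom: "bounded \<Omega>" and open_dom: "open \<Omega>" and convex_dom: "convex \<Omega>"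
    and compact_F: "compact F" and F_dom: "F \<subseteq> \<Omega>"
    and F_eq: "F = (\<Union>i\<in>{1..N}. \<phi> i ` F)"
    and two_points: "\<exists>x\<in>F. \<exists>y\<in>F. x \<noteq> y"
    and inj_phi: "i \<in> {1..N} \<Longrightarrow> inj_on (\<phi> i) \<Omega>"
    and phi_dom: "i \<in> {1..N} \<Longrightarrow> x \<in> \<Omega> \<Longrightarrow> \<phi> i x \<in> \<Omega>"
    and deriv_phi: "i \<in> {1..N} \<Longrightarrow> x \<in> \<Omega> \<Longrightarrow> (\<phi> i has_derivative D i x) (at x)"
    and conf_D: "i \<in> {1..N} \<Longrightarrow> x \<in> \<Omega> \<Longrightarrow> norm (D i x y) = norm (D i x) * norm y"
    and D_lower: "i \<in> {1..N} \<Longrightarrow> x \<in> F \<Longrightarrow> m \<le> norm (D i x)"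
    and D_upper: "i \<in> {1..N} \<Longrightarrow> x \<in> \<Omega> \<Longrightarrow> norm (D i x) \<le> lam"
    and D_holder: "i \<in> {1..N} \<Longrightarrow> x \<in> \<Omega> \<Longrightarrow> y \<in> \<Omega> \<Longrightarrow>
        norm (D i x - D i y) \<le> c * norm (x - y) powr \<alpha>"
    and pos: "0 < \<alpha>" "0 < c" "0 < m" "0 < lam" and lam_less_1: "lam < 1"
begin

declare One_nat_def [simp del] atLeastAtMost_iff [simp del]

abbreviation W :: "nat list \<Rightarrow> 'a \<Rightarrow> 'a" where "W \<equiv> word_map \<phi>"
abbreviation s :: "nat list \<Rightarrow> real" where "s w \<equiv> deriv_sup_norm \<Omega> (W w)"

section \<open>Derivatives and Lipschitz bounds of word maps\<close>

primrec DW :: "nat list \<Rightarrow> 'a \<Rightarrow> 'a \<Rightarrow>\<^sub>L 'a" where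
  "DW [] x = id_blinfun"
| "DW (i # w) x = D i (W w x) o\<^sub>L DW w x"

lemma phi_F: "i \<in> {1..N} \<Longrightarrow> x \<in> F \<Longrightarrow> \<phi> i x \<in> F"
  using F_eq by blast

lemma W_dom: "w \<in> words N \<Longrightarrow> x \<in> \<Omega> \<Longrightarrow> W w x \<in> \<Omega>"
  by (induction w) (auto intro: phi_dom)

lemma W_F: "w \<in> words N \<Longrightarrow> x \<in> F \<Longrightarrow> W w x \<in> F"
  by (induction w) (auto intro: phi_F)

lemma inj_on_W: "w \<in> words N \<Longrightarrow> inj_on (W w) \<Omega>"
proof (induction w)
  case (Cons i w)
  then have "inj_on (\<phi> i) (W w ` \<Omega>)"
    by (auto intro!: inj_on_subset[OF inj_phi] W_dom)
  with Cons show ?case by (simp add: comp_inj_on del: comp_apply)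
qed simp

lemma deriv_W: "w \<in> words N \<Longrightarrow> x \<in> \<Omega> \<Longrightarrow> (W w has_derivative DW w x) (at x)"
proof (induction w)
  case (Cons i w)
  then have "(\<phi> i \<circ> W w has_derivative blinfun_apply (D i (W w x)) \<circ> blinfun_apply (DW w x)) (at x)"
    by (intro diff_chain_at deriv_phi W_dom) auto
  then show ?case by (simp add: o_def)
next
  case Nil
  have "blinfun_apply id_blinfun = (\<lambda>x::'a. x)" by auto
  then show ?case by (simp add: id_def)
qed

lemma norm_DW_Cons:
  "i \<in> {1..N} \<Longrightarrow> w \<in> words N \<Longrightarrow> x \<in> \<Omega> \<Longrightarrow>
    norm (DW (i # w) x) = norm (D i (W w x)) * norm (DW w x)"
  by (simp add: norm_compose_conformal conf_D W_dom)

lemma conf_DW: "w \<in> words N \<Longrightarrow> x \<in> \<Omega> \<Longrightarrow> norm (DW w x y) = norm (DW w x) * norm y"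
proof (induction w)
  case (Cons i w)
  then show ?case
    using norm_DW_Cons[of i w x] by (simp add: conf_D W_dom )
qed simp

lemma norm_DW_append:
  "v \<in> words N \<Longrightarrow> w \<in> words N \<Longrightarrow> x \<in> \<Omega> \<Longrightarrow>
    norm (DW (v @ w) x) = norm (DW v (W w x)) * norm (DW w x)"
proof (induction v)
  case (Cons i v)
  then have "norm (DW ((i # v) @ w) x) = norm (D i (W v (W w x))) * norm (DW (v @ w) x)"
    using norm_DW_Cons[of i "v @ w" x] by (simp add: word_map_append)
  with Cons show ?case
    using norm_DW_Cons[of i v "W w x"] by (simp add: W_dom del: DW.simps)
qed simp

lemma norm_DW_le: "w \<in> words N \<Longrightarrow> x \<in> \<Omega> \<Longrightarrow> norm (DW w x) \<le> lam ^ length w"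
proof (induction w)
  case (Cons i w)
  then show ?case
    using norm_DW_Cons[of i w x] D_upper[of i "W w x"] pos W_dom[of w x]
    by (auto intro!: mult_mono simp del: DW.simps)
qed simp

lemma norm_DW_pos: "w \<in> words N \<Longrightarrow> x \<in> F \<Longrightarrow> 0 < norm (DW w x)"
proof (induction w)
  case (Cons i w)
  then have "0 < norm (D i (W w x))"
    using D_lower[of i "W w x"] pos W_F by (force simp del: zero_less_norm_iff)
  with Cons show ?case
    using norm_DW_Cons[of i w x] F_dom by (auto simp del: DW.simps zero_less_norm_iff)
qed simp

lemma F_nonempty: "F \<noteq> {}"
  using two_points by auto

lemma s_eq: "w \<in> words N \<Longrightarrow> s w = (SUP x\<in>\<Omega>. norm (DW w x))"
  unfolding deriv_sup_norm_def norm_blinfun.rep_eq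
  by (intro SUP_cong refl) (metis deriv_W frechet_derivative_at)

lemma bdd_DW: "w \<in> words N \<Longrightarrow> bdd_above ((\<lambda>x. norm (DW w x)) ` \<Omega>)"
  using norm_DW_le by (intro bdd_aboveI2) auto

lemma norm_DW_le_s: "w \<in> words N \<Longrightarrow> x \<in> \<Omega> \<Longrightarrow> norm (DW w x) \<le> s w"
  by (simp add: s_eq) (rule cSUP_upper[OF _ bdd_DW])

lemma s_leI: "w \<in> words N \<Longrightarrow> (\<And>x. x \<in> \<Omega> \<Longrightarrow> norm (DW w x) \<le> B) \<Longrightarrow> s w \<le> B"
  using F_nonempty F_dom by (auto simp: s_eq intro!: cSUP_least)

lemma s_pos: "w \<in> words N \<Longrightarrow> 0 < s w"
  using F_nonempty F_dom norm_DW_pos norm_DW_le_s by (meson ex_in_conv less_le_trans subsetD)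

lemma s_le_power: "w \<in> words N \<Longrightarrow> s w \<le> lam ^ length w"
  by (intro s_leI norm_DW_le)

lemma s_Nil: "s [] = 1"
proof -
  have "\<Omega> \<noteq> {}" using F_nonempty F_dom by auto
  then show ?thesis using s_eq[of "[]"] by simp
qed

lemma s_append_le: "v \<in> words N \<Longrightarrow> w \<in> words N \<Longrightarrow> s (v @ w) \<le> s v * s w"
  by (intro s_leI) (auto simp: norm_DW_append intro!: mult_mono norm_DW_le_s W_dom less_imp_le[OF s_pos])

lemma W_lipschitz:
  assumes "w \<in> words N" "x \<in> \<Omega>" "y \<in> \<Omega>"
  shows "norm (W w x - W w y) \<le> s w * norm (x - y)"
  using assms convex_dom
  by (intro differentiable_bound[where S = \<Omega> and f' = "\<lambda>x. DW w x"])
     (auto simp flip: norm_blinfun.rep_eq intro: norm_DW_le_s has_derivative_at_withinI[OF deriv_W])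

lemma continuous_W: "w \<in> words N \<Longrightarrow> continuous_on F (W w)"
  using F_dom deriv_W by (blast intro: continuous_at_imp_continuous_on has_derivative_continuous)

lemma compact_W_F: "w \<in> words N \<Longrightarrow> compact (W w ` F)"
  using compact_continuous_image continuous_W compact_F by blast

section \<open>Bounded distortion and Hoelder control of derivatives along words\<close>

definition \<Delta> :: real where "\<Delta> = diameter \<Omega>"

lemma dist_dom: "x \<in> \<Omega> \<Longrightarrow> y \<in> \<Omega> \<Longrightarrow> norm (x - y) \<le> \<Delta>"
  unfolding \<Delta>_def using diameter_bounded_bound[OF bounded_dom] by (simp add: dist_norm)

lemma \<Delta>_pos: "0 < \<Delta>"
proof -
  obtain x y where "x \<in> F" "y \<in> F" "x \<noteq> y" using two_points by blast
  then show ?thesis using dist_dom[of x y] F_dom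
    by (meson less_le_trans right_minus_eq subsetD zero_less_norm_iff)
qed

text \<open>Each letter contracts distances by \<open>lam\<close>, hence their \<alpha>-th powers by
  \<open>q\<close>; this is the ratio of the geometric series that sum the Hoelder errors along a
  word.\<close>

definition q :: real where "q = lam powr \<alpha>"

lemma q: "0 < q" "q < 1"
  using pos lam_less_1 using powr_less_mono'[of lam 0 \<alpha>] by (auto simp: q_def)

lemma W_powr:
  assumes "w \<in> words N" "x \<in> \<Omega>" "y \<in> \<Omega>"
  shows "norm (W w x - W w y) powr \<alpha> \<le> q ^ length w * norm (x - y) powr \<alpha>"
proof -
  have "norm (W w x - W w y) \<le> lam ^ length w * norm (x - y)"
    using W_lipschitz[OF assms] s_le_power[OF assms(1)]
    by (meson mult_right_mono norm_ge_zero order_trans)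
  then have "norm (W w x - W w y) powr \<alpha> \<le> (lam ^ length w * norm (x - y)) powr \<alpha>"
    using pos by (intro powr_mono2) auto
  also have "\<dots> = q ^ length w * norm (x - y) powr \<alpha>"
    using pos by (simp add: powr_mult q_def powr_powr mult.commute flip: powr_realpow)
  finally show ?thesis .
qed

text \<open>Along a word the logarithms of the ratios of derivatives are bounded by a geometric series, whence
  the exponential.\<close>

definition C1 :: real where "C1 = exp (c / m * \<Delta> powr \<alpha> / (1 - q))"

lemma C1_ge_1: "1 \<le> C1"
  using pos q \<Delta>_pos by (simp add: C1_def)

lemma distortion:
  assumes "w \<in> words N" "x \<in> F" "y \<in> \<Omega>"
  shows "norm (DW w y) \<le> C1 * norm (DW w x)"
proof -
  define B where "B = c / m * \<Delta> powr \<alpha>"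
  have "0 \<le> B" using pos by (simp add: B_def)
  \<comment> \<open>Prepending a letter brings in the ratio of \<open>D i\<close> at two points
    whose distance has already shrunk through \<open>length w\<close> letters; it contributes the
    next term of the geometric sum in the exponent.\<close>
  have "norm (DW w y) \<le> exp (B * (\<Sum>j<length w. q ^ j)) * norm (DW w x)" using assms(1)
  proof (induction w)
    case (Cons i w)
    then have iw: "i \<in> {1..N}" "w \<in> words N" by auto
    let ?X = "W w x" and ?Y = "W w y"
    have X: "?X \<in> F" "?X \<in> \<Omega>" "x \<in> \<Omega>" "?Y \<in> \<Omega>" 
      using iw assms F_dom by (auto intro: W_F W_dom)
    have "norm (D i ?Y - D i ?X) \<le> c * norm (?Y - ?X) powr \<alpha>"
      using D_holder iw X by auto
    also have "\<dots> \<le> c * (q ^ length w * \<Delta> powr \<alpha>)"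
      using W_powr[OF iw(2) assms(3) X(3)] dist_dom[OF assms(3) X(3)] pos q
      by (intro mult_left_mono order_trans[OF W_powr[OF iw(2) assms(3) X(3)]] powr_mono2) auto
    also have "\<dots> = m * (B * q ^ length w)"
      using pos by (simp add: B_def)
    \<comment> \<open>Trading \<open>m\<close> for \<open>norm (D i ?X)\<close> makes the error
      relative, so that it can enter a product.\<close>
    also have "\<dots> \<le> norm (D i ?X) * (B * q ^ length w)"
      using D_lower[OF iw(1) X(1)] \<open>0 \<le> B\<close> q by (intro mult_right_mono) auto
    finally have "norm (D i ?Y - D i ?X) \<le> norm (D i ?X) * (B * q ^ length w)" .
    then have "norm (D i ?Y) \<le> norm (D i ?X) * (1 + B * q ^ length w)"
      using norm_triangle_sub[of "D i ?Y" "D i ?X"] by (simp add: algebra_simps)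
    also have "\<dots> \<le> norm (D i ?X) * exp (B * q ^ length w)"
      by (intro mult_left_mono exp_ge_add_one_self) auto
    finally have "norm (D i ?Y) * norm (DW w y) \<le>
        (norm (D i ?X) * exp (B * q ^ length w)) * (exp (B * (\<Sum>j<length w. q ^ j)) * norm (DW w x))"
      using Cons by (intro mult_mono) auto
    then show ?case
      using iw X assms by (simp add: norm_DW_Cons algebra_simps exp_add del: DW.simps)
  qed simp
  also have "\<dots> \<le> C1 * norm (DW w x)"
  proof (rule mult_right_mono)
    have "(\<Sum>j<length w. q ^ j) \<le> 1 / (1 - q)"
      using q by (simp add: sum_gp_strict divide_right_mono)
    then have "B * (\<Sum>j<length w. q ^ j) \<le> B / (1 - q)"
      using mult_left_mono[OF _ \<open>0 \<le> B\<close>] by fastforce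
    then show "exp (B * (\<Sum>j<length w. q ^ j)) \<le> C1" by (simp add: C1_def B_def)
  qed simp
  finally show ?thesis .
qed

lemma s_le_norm_DW: "w \<in> words N \<Longrightarrow> x \<in> F \<Longrightarrow> s w \<le> C1 * norm (DW w x)"
  by (intro s_leI distortion)

text \<open>Each supremum is at most \<open>C1\<close> times the derivative norm at any point of
  \<open>F\<close>, and at such a point the norms multiply exactly.\<close>

lemma s_append_ge:
  assumes "v \<in> words N" "w \<in> words N"
  shows "s v * s w \<le> C1\<^sup>2 * s (v @ w)"
proof -
  obtain x where x: "x \<in> F" "x \<in> \<Omega>" using F_nonempty F_dom by auto
  have "s v * s w \<le> (C1 * norm (DW v (W w x))) * (C1 * norm (DW w x))"
    using assms x C1_ge_1 by (intro mult_mono s_le_norm_DW W_F) (auto intro!: less_imp_le[OF s_pos])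
  also have "\<dots> = C1\<^sup>2 * norm (DW (v @ w) x)"
    using assms x by (simp add: norm_DW_append power2_eq_square)
  also have "\<dots> \<le> C1\<^sup>2 * s (v @ w)"
    using assms x by (intro mult_left_mono norm_DW_le_s) auto
  finally show ?thesis .
qed

definition C2 :: real where "C2 = c * C1 / m / (1 - q)"

lemma C2_pos: "0 < C2"
  using pos q C1_ge_1 by (simp add: C2_def)

text \<open>The error caused by each letter decays geometrically, and distortion measures all errors
  against the same derivative norm. So the Hoelder constant relative to \<open>s w\<close> is
  independent of the word.\<close>

lemma DW_holder:
  assumes "w \<in> words N" "x \<in> F" "y \<in> \<Omega>"
  shows "norm (DW w x - DW w y) \<le> C2 * s w * norm (x - y) powr \<alpha>"
proof -
  define B where "B = c * C1 / m"
  define P where "P = norm (x - y) powr \<alpha>"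
  have "0 \<le> B" "0 \<le> P" using pos C1_ge_1 by (auto simp: B_def P_def)
  have "norm (DW w x - DW w y) \<le> B * (\<Sum>j<length w. q ^ j) * P * norm (DW w x)" using assms(1)
  proof (induction w)
    case (Cons i w)
    then have iw: "i \<in> {1..N}" "w \<in> words N" by auto
    let ?X = "W w x" and ?Y = "W w y"
    have X: "?X \<in> F" "?X \<in> \<Omega>" "x \<in> \<Omega>" "?Y \<in> \<Omega>" 
      using iw assms F_dom by (auto intro: W_F W_dom)
    have "norm (D i ?X - D i ?Y) \<le> c * norm (?X - ?Y) powr \<alpha>"
      using D_holder iw X by auto
    also have "\<dots> \<le> c * (q ^ length w * P)"
      unfolding P_def using pos by (intro mult_left_mono W_powr iw assms X) auto
    finally have "norm (D i ?X - D i ?Y) * norm (DW w y) \<le> c * (q ^ length w * P) * (C1 * norm (DW w x))"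
      using distortion[OF iw(2) assms(2,3)] pos q \<open>0 \<le> P\<close> by (intro mult_mono) auto
    also have "\<dots> = m * (B * q ^ length w * P * norm (DW w x))"
      using pos by (simp add: B_def)
    also have "\<dots> \<le> norm (D i ?X) * (B * q ^ length w * P * norm (DW w x))"
      using D_lower[OF iw(1) X(1)] \<open>0 \<le> B\<close> \<open>0 \<le> P\<close> q by (intro mult_right_mono) auto
    finally have 1: "norm ((D i ?X - D i ?Y) o\<^sub>L DW w y) \<le> norm (D i ?X) * (B * q ^ length w * P * norm (DW w x))"
      using norm_blinfun_compose order_trans by blast
    have "norm (D i ?X o\<^sub>L (DW w x - DW w y)) \<le> norm (D i ?X) * norm (DW w x - DW w y)"
      by (rule norm_blinfun_compose)
    also have "\<dots> \<le> norm (D i ?X) * (B * (\<Sum>j<length w. q ^ j) * P * norm (DW w x))"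
      using Cons by (intro mult_left_mono) auto
    finally have 2: "norm (D i ?X o\<^sub>L (DW w x - DW w y)) \<le> \<dots>" .
    \<comment> \<open>The first summand carries the induction hypothesis, the second the variation
      of the outer letter.\<close>
    have "DW (i # w) x - DW (i # w) y = (D i ?X o\<^sub>L (DW w x - DW w y)) + ((D i ?X - D i ?Y) o\<^sub>L DW w y)"
      by (rule blinfun_eqI) (simp add: blinfun.bilinear_simps)
    then have "norm (DW (i # w) x - DW (i # w) y) \<le>
      norm (D i ?X) * (B * (\<Sum>j<length w. q ^ j) * P * norm (DW w x)) +
      norm (D i ?X) * (B * q ^ length w * P * norm (DW w x))"
      using norm_triangle_mono[OF 2 1] by simp
    then show ?case
      using iw X norm_DW_Cons[OF iw X(3)] by (simp add: algebra_simps del: DW.simps)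
  qed simp
  also have "\<dots> \<le> B * (1 / (1 - q)) * P * s w"
  proof (intro mult_mono)
    show "(\<Sum>j<length w. q ^ j) \<le> 1 / (1 - q)"
      using q by (simp add: sum_gp_strict divide_right_mono)
    show "norm (DW w x) \<le> s w" using assms F_dom norm_DW_le_s by blast
  qed (use \<open>0 \<le> B\<close> \<open>0 \<le> P\<close> q in \<open>auto intro!: sum_nonneg\<close>)
  finally show ?thesis by (simp add: B_def C2_def P_def mult_ac)
qed

section \<open>Linearization and lower bounds at small distances\<close>

text \<open>The segment between the two points stays in \<Omega> by convexity but may leave
  \<open>F\<close>, which is why \<open>DW_holder\<close> admits any second point of
  \<Omega>.\<close>

lemma W_taylor:
  assumes "w \<in> words N" "x \<in> F" "y \<in> F"
  shows "norm (W w y - W w x - DW w x (y - x)) \<le> C2 * s w * norm (y - x) powr \<alpha> * norm (y - x)"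
proof -
  let ?S = "closed_segment x y"
  have S: "?S \<subseteq> \<Omega>"
    using assms F_dom convex_dom by (intro closed_segment_subset) auto
  have "norm (W w y - W w x - DW w x (y - x)) \<le> norm (y - x) * (C2 * s w * norm (y - x) powr \<alpha>)"
  proof (rule differentiable_bound_linearization[where S = ?S and f' = "\<lambda>z. blinfun_apply (DW w z)"])
    show "x + t *\<^sub>R (y - x) \<in> ?S" if "t \<in> {0..1}" for t
      using that by (auto simp: closed_segment_def algebra_simps atLeastAtMost_iff intro!: exI[of _ t])
    show "(W w has_derivative DW w z) (at z within ?S)" if "z \<in> ?S" for z
      using that S assms by (blast intro: has_derivative_at_withinI deriv_W)
    show "onorm (blinfun_apply (DW w z) - blinfun_apply (DW w x)) \<le> C2 * s w * norm (y - x) powr \<alpha>"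
      if "z \<in> ?S" for z
    proof -
      have eq: "blinfun_apply (DW w z) - blinfun_apply (DW w x) = blinfun_apply (DW w z - DW w x)"
        by (auto simp: blinfun.bilinear_simps)
      have "norm (DW w z - DW w x) \<le> C2 * s w * norm (x - z) powr \<alpha>"
        using DW_holder[of w x z] that S assms by (subst norm_minus_commute) blast
      also have "\<dots> \<le> C2 * s w * norm (y - x) powr \<alpha>"
        using segment_bound1[OF that] pos C2_pos s_pos[OF assms(1)]
        by (intro mult_left_mono powr_mono2) (auto simp: norm_minus_commute)
      finally show ?thesis by (simp add: eq norm_blinfun.rep_eq)
    qed
  qed auto
  then show ?thesis by (simp add: mult_ac)
qed

text \<open>The distance at which the relative Taylor error \<open>C2 * \<rho> powr \<alpha>\<close>
  equals half of the lower derivative bound \<open>1 / C1\<close>.\<close>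

definition \<rho> :: real where "\<rho> = (1 / (2 * C1 * C2)) powr (1 / \<alpha>)"

lemma \<rho>_pos: "0 < \<rho>"
  using C1_ge_1 C2_pos by (simp add: \<rho>_def)

lemma \<rho>_powr:
  assumes t: "0 \<le> t" "t \<le> \<rho>"
  shows "C2 * t powr \<alpha> \<le> 1 / (2 * C1)"
proof -
  have "t powr \<alpha> \<le> \<rho> powr \<alpha>" using t pos by (intro powr_mono2) auto
  also have "\<dots> = 1 / (2 * C1 * C2)"
    using pos C1_ge_1 C2_pos by (simp add: \<rho>_def powr_powr)
  finally show ?thesis using C1_ge_1 C2_pos by (simp add: field_simps)
qed

text \<open>The derivative at \<open>x\<close> stretches by at least \<open>s w / C1\<close>, and up
  to distance \<rho> the Taylor remainder consumes at most half of that. Injectivity alone would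
  give no bound uniform in the word.\<close>

lemma W_lower:
  assumes "w \<in> words N" "x \<in> F" "y \<in> F" "norm (x - y) \<le> \<rho>"
  shows "s w * norm (x - y) \<le> 2 * C1 * norm (W w x - W w y)"
proof -
  let ?n = "norm (y - x)"
  have "s w * ?n / C1 \<le> norm (DW w x) * ?n"
    using mult_right_mono[OF s_le_norm_DW[OF assms(1,2)], of ?n] C1_ge_1
    by (simp add: pos_divide_le_eq mult_ac)
  also have "\<dots> = norm (DW w x (y - x))"
    using assms F_dom conf_DW[of w x] by auto
  also have "\<dots> \<le> norm (W w y - W w x) + norm (W w y - W w x - DW w x (y - x))"
    using norm_triangle_ineq4[of "W w y - W w x" "W w y - W w x - DW w x (y - x)"] by simp
  also have "\<dots> \<le> norm (W w y - W w x) + (C2 * ?n powr \<alpha>) * (s w * ?n)"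
    using W_taylor[OF assms(1-3)] by (simp add: mult_ac)
  also have "\<dots> \<le> norm (W w y - W w x) + 1 / (2 * C1) * (s w * ?n)"
    using assms less_imp_le[OF s_pos[OF assms(1)]]
    by (intro add_left_mono mult_right_mono \<rho>_powr) (auto simp: norm_minus_commute)
  finally show ?thesis
    using C1_ge_1 by (simp add: field_simps norm_minus_commute)
qed

section \<open>Images of F under words: diameters and scales\<close>

lemma F_cover: "x \<in> F \<Longrightarrow> \<exists>u\<in>words N. length u = n \<and> x \<in> W u ` F"
proof (induction n arbitrary: x)
  case (Suc n)
  then obtain i y where i: "i \<in> {1..N}" "y \<in> F" "x = \<phi> i y" using F_eq by blast
  with Suc.IH[of y] obtain u where "u \<in> words N" "length u = n" "y \<in> W u ` F" by blast
  with i show ?case by (intro bexI[of _ "i # u"]) auto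
qed auto

text \<open>A long word contracts two distinct points of \<open>F\<close> to a small distance, and
  injectivity keeps them apart. This supplies test pairs for \<open>W_lower\<close>.\<close>

lemma close_points:
  assumes "0 < t"
  obtains x y where "x \<in> F" "y \<in> F" "x \<noteq> y" "norm (x - y) \<le> t"
proof -
  obtain a b where ab: "a \<in> F" "b \<in> F" "a \<noteq> b" using two_points by blast
  obtain n where n: "lam ^ n < t / \<Delta>"
    using real_arch_pow_inv[of "t / \<Delta>" lam] assms \<Delta>_pos lam_less_1 by auto
  obtain u where u: "u \<in> words N" "length u = n" using F_cover[OF ab(1)] by blast
  have "norm (W u a - W u b) \<le> s u * norm (a - b)"
    using W_lipschitz u ab F_dom by blast
  also have "\<dots> \<le> lam ^ n * \<Delta>"
    using s_le_power[OF u(1)] u dist_dom[of a b] ab F_dom pos by (intro mult_mono) auto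
  also have "\<dots> \<le> t" using n \<Delta>_pos by (simp add: field_simps)
  finally show thesis
    using that[of "W u a" "W u b"] u ab W_F inj_onD[OF inj_on_W[OF u(1)], of a b] F_dom by blast
qed

lemma diameter_W_le:
  assumes "w \<in> words N" shows "diameter (W w ` F) \<le> s w * \<Delta>"
proof (rule diameter_le)
  show "norm (x - y) \<le> s w * \<Delta>" if "x \<in> W w ` F" "y \<in> W w ` F" for x y
  proof -
    obtain a b where ab: "a \<in> \<Omega>" "b \<in> \<Omega>" "x = W w a" "y = W w b"
      using \<open>x \<in> W w ` F\<close> \<open>y \<in> W w ` F\<close> F_dom by blast
    have "norm (x - y) \<le> s w * norm (a - b)" using W_lipschitz[OF assms] ab by simp
    also have "\<dots> \<le> s w * \<Delta>" 
      using ab dist_dom less_imp_le[OF s_pos[OF assms]] by (intro mult_left_mono) auto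
    finally show ?thesis .
  qed
qed (use F_nonempty in auto)

lemma dist_le_diameter_W:
  assumes "w \<in> words N" "x \<in> F" "y \<in> F"
  shows "norm (W w x - W w y) \<le> diameter (W w ` F)"
  using diameter_bounded_bound[OF compact_imp_bounded[OF compact_W_F[OF assms(1)]], of "W w x" "W w y"] assms
  by (simp add: dist_norm)

text \<open>One fixed pair at distance at most \<rho> is spread by every word in proportion to
  \<open>s w\<close>. With \<open>diameter_W_le\<close>, derivative norm and diameter become
  interchangeable measures of scale.\<close>

lemma s_le_diameter: "\<exists>C>0. \<forall>w\<in>words N. s w \<le> C * diameter (W w ` F)"
proof -
  obtain a b where ab: "a \<in> F" "b \<in> F" "a \<noteq> b" "norm (a - b) \<le> \<rho>"
    using close_points[OF \<rho>_pos] .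
  have "s w \<le> 2 * C1 / norm (a - b) * diameter (W w ` F)" if w: "w \<in> words N" for w
  proof -
    have "s w * norm (a - b) \<le> 2 * C1 * norm (W w a - W w b)"
      using W_lower w ab by blast
    also have "\<dots> \<le> 2 * C1 * diameter (W w ` F)"
      using dist_le_diameter_W w ab C1_ge_1 by (intro mult_left_mono) auto
    finally show ?thesis using ab by (simp add: field_simps)
  qed
  then show ?thesis using ab C1_ge_1 by (intro exI[of _ "2 * C1 / norm (a - b)"]) auto
qed

lemma diameter_W_pos: "w \<in> words N \<Longrightarrow> 0 < diameter (W w ` F)"
  using s_le_diameter s_pos by (metis less_le_trans zero_less_mult_pos)

lemma diameter_W_perturb:
  assumes "v \<in> words N" "w \<in> words N" "\<And>x. x \<in> F \<Longrightarrow> norm (W v x - W w x) \<le> \<eta>"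
  shows "diameter (W v ` F) \<le> diameter (W w ` F) + 2 * \<eta>"
proof (rule diameter_le)
  show "norm (x - y) \<le> diameter (W w ` F) + 2 * \<eta>" if xy: "x \<in> W v ` F" "y \<in> W v ` F" for x y
  proof -
    obtain a b where ab: "a \<in> F" "b \<in> F" "x = W v a" "y = W v b"
      using xy by blast
    have "norm (x - y) \<le> norm (W v a - W w a) + norm (W w a - W w b) + norm (W v b - W w b)"
      unfolding ab by norm
    also have "\<dots> \<le> \<eta> + diameter (W w ` F) + \<eta>"
      using ab assms by (intro add_mono dist_le_diameter_W) auto
    finally show ?thesis by simp
  qed
qed (use F_nonempty in auto)

text \<open>A single letter has derivative norm at least \<open>m\<close> on \<open>F\<close>, so
  deleting it enlarges the scale by a bounded factor only.\<close>

lemma s_butlast: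
  assumes "w \<in> words N" "w \<noteq> []"
  shows "m * s (butlast w) \<le> C1\<^sup>2 * s w"
proof -
  obtain x where x: "x \<in> F" using F_nonempty by blast
  have w: "butlast w \<in> words N" "last w \<in> {1..N}" "w = butlast w @ [last w]"
    using assms by (auto simp: in_lists_conv_set dest: in_set_butlastD)
  have "m \<le> norm (DW [last w] x)"
    using D_lower w x F_dom norm_DW_Cons[of "last w" "[]" x] by auto
  also have "\<dots> \<le> s [last w]"
    using w x F_dom by (intro norm_DW_le_s) auto
  finally have "s (butlast w) * m \<le> s (butlast w) * s [last w]"
    using less_imp_le[OF s_pos] w by (intro mult_left_mono) auto
  also have "\<dots> \<le> C1\<^sup>2 * s (butlast w @ [last w])"
    using w by (intro s_append_ge) auto
  finally show ?thesis using w by (simp add: mult.commute)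
qed

text \<open>Take a shortest word through \<open>x\<close> with \<open>s u \<le> t\<close>. Its
  parent also passes through \<open>x\<close>, so by minimality it exceeds \<open>t\<close>, and
  \<open>s_butlast\<close> bounds the drop.\<close>

lemma word_at_scale:
  assumes "x \<in> F" "0 < t" "t \<le> 1"
  obtains u where "u \<in> words N" "x \<in> W u ` F" "s u \<le> t" "m * t \<le> C1\<^sup>2 * s u"
proof -
  let ?P = "\<lambda>n. \<exists>u\<in>words N. length u = n \<and> x \<in> W u ` F \<and> s u \<le> t"
  obtain n where "lam ^ n < t"
    using real_arch_pow_inv assms lam_less_1 by blast
  then have "?P n"
    using F_cover[OF assms(1), of n] s_le_power by fastforce
  then have "?P (LEAST n. ?P n)" by (rule LeastI)
  then obtain u where u: "u \<in> words N" "length u = (LEAST n. ?P n)" "x \<in> W u ` F" "s u \<le> t"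
    by blast
  have "m * t \<le> C1\<^sup>2 * s u"
  proof (cases "u = []")
    \<comment> \<open>The empty word has no parent; here \<open>s [] = 1\<close>,
      \<open>t \<le> 1\<close> and \<open>m \<le> lam < 1\<close> suffice.\<close>
    case True
    obtain i y where "i \<in> {1..N}" "y \<in> F" using assms F_eq by blast
    then have "m \<le> 1" using D_lower[of i y] D_upper[of i y] F_dom lam_less_1 by auto
    moreover have "1 \<le> C1\<^sup>2" using C1_ge_1 by simp
    ultimately have "m * t \<le> C1\<^sup>2 * 1"
      using assms pos by (intro mult_mono) auto
    then show ?thesis using True s_Nil by simp
  next
    case False
    have bu: "butlast u \<in> words N" "last u \<in> {1..N}" "u = butlast u @ [last u]"
      using u False by (auto simp: in_lists_conv_set dest: in_set_butlastD)
    have "\<not> ?P (length (butlast u))"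
      using u(2) False by (intro not_less_Least) (metis length_butlast diff_less length_greater_0_conv zero_less_one)
    moreover have "x \<in> W (butlast u) ` F"
    proof -
      obtain y where y: "y \<in> F" "x = W u y" using u by auto
      have "W u y = W (butlast u) (W [last u] y)"
        using bu(3) word_map_append by metis
      moreover have "W [last u] y \<in> F" using W_F[of "[last u]"] bu y by simp
      ultimately show ?thesis using y by blast
    qed
    ultimately have "\<not> s (butlast u) \<le> t" using bu(1) by blast
    then have "m * t \<le> m * s (butlast u)" using pos by (intro mult_left_mono) auto
    also have "\<dots> \<le> C1\<^sup>2 * s u" using s_butlast u False by blast
    finally show ?thesis .
  qed
  with u that show thesis by blast
qed

section \<open>The identity limit criterion implies weak separation\<close>

lemma difference_attains_sup:
  assumes "v \<in> words N" "w \<in> words N"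
  obtains x where "x \<in> F" "\<And>y. y \<in> F \<Longrightarrow> norm (W v y - W w y) \<le> norm (W v x - W w x)"
proof -
  have "continuous_on F (\<lambda>x. norm (W v x - W w x))"
    by (intro continuous_intros continuous_W assms)
  then show thesis
    using continuous_attains_sup[OF compact_F F_nonempty] that by blast
qed

text \<open>By compactness each supremum is attained, so a lower bound for the infimum becomes an
  inequality at a single point.\<close>

lemma identity_limit_criterion_iff:
  "identity_limit_criterion N \<phi> \<Omega> F \<longleftrightarrow>
    (\<exists>\<epsilon>>0. \<forall>v\<in>words N. \<forall>w\<in>words N. (\<exists>x\<in>F. W v x \<noteq> W w x) \<longrightarrow>
      (\<exists>x\<in>F. \<epsilon> * s v \<le> norm (W v x - W w x)))" (is "_ \<longleftrightarrow> ?R")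
proof -
  define E where "E v w = inverse (s v) * (SUP x\<in>F. norm (W v x - W w x))" for v w
  have E: "\<epsilon> \<le> E v w \<longleftrightarrow> (\<exists>x\<in>F. \<epsilon> * s v \<le> norm (W v x - W w x))"
    if vw: "v \<in> words N" "w \<in> words N" for v w \<epsilon>
  proof -
    obtain x where x: "x \<in> F" "\<And>y. y \<in> F \<Longrightarrow> norm (W v y - W w y) \<le> norm (W v x - W w x)"
      using difference_attains_sup[OF vw] by metis
    have "(SUP x\<in>F. norm (W v x - W w x)) = norm (W v x - W w x)"
      using x by (intro cSup_eq_maximum) auto
    then have "\<epsilon> \<le> E v w \<longleftrightarrow> \<epsilon> * s v \<le> norm (W v x - W w x)"
      using s_pos[OF vw(1)] by (simp add: E_def field_simps)
    then show ?thesis using x by (meson order_trans)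
  qed
  let ?S = "{ereal (E v w) | v w. v \<in> words N \<and> w \<in> words N \<and> restrict (W v) F \<noteq> restrict (W w) F}"
  have "identity_limit_criterion N \<phi> \<Omega> F \<longleftrightarrow> Inf ?S > 0"
    unfolding identity_limit_criterion_def E_def ..
  also have "\<dots> \<longleftrightarrow> (\<exists>\<epsilon>>0. \<forall>e\<in>?S. ereal \<epsilon> \<le> e)"
  proof
    assume "0 < Inf ?S"
    \<comment> \<open>The infimum is an extended real, so a real number is interpolated strictly
      below it.\<close>
    then obtain \<epsilon> where "0 < ereal \<epsilon>" "ereal \<epsilon> < Inf ?S" using ereal_dense2 by blast
    then show "\<exists>\<epsilon>>0. \<forall>e\<in>?S. ereal \<epsilon> \<le> e"
      by (intro exI[of _ \<epsilon>]) (auto intro: order_trans[OF less_imp_le Inf_lower])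
  next
    assume "\<exists>\<epsilon>>0. \<forall>e\<in>?S. ereal \<epsilon> \<le> e"
    then obtain \<epsilon> where "0 < \<epsilon>" "\<forall>e\<in>?S. ereal \<epsilon> \<le> e" by blast
    then have "ereal \<epsilon> \<le> Inf ?S" by (intro Inf_greatest) blast
    with \<open>0 < \<epsilon>\<close> show "0 < Inf ?S" by (meson ereal_less(2) less_le_trans)
  qed
  also have "\<dots> \<longleftrightarrow> (\<exists>\<epsilon>>0. \<forall>v\<in>words N. \<forall>w\<in>words N. (\<exists>x\<in>F. W v x \<noteq> W w x) \<longrightarrow> \<epsilon> \<le> E v w)"
  proof -
    have "(\<forall>e\<in>?S. ereal \<epsilon> \<le> e) \<longleftrightarrow>
        (\<forall>v\<in>words N. \<forall>w\<in>words N. (\<exists>x\<in>F. W v x \<noteq> W w x) \<longrightarrow> \<epsilon> \<le> E v w)" for \<epsilon>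
      unfolding restrict_eq_iff using ereal_less_eq(3) by blast
    then show ?thesis by simp
  qed
  also have "\<dots> \<longleftrightarrow> ?R" by (simp add: E cong: ball_cong)
  finally show ?thesis .
qed

text \<open>Each map in \<Phi>(x,r) is coded by its rescaled values on a finite net of
  \<open>F\<close>, rounded to a finite net of a ball. The criterion makes the code injective, and
  the number of codes depends on neither \<open>x\<close> nor \<open>r\<close>.\<close>

lemma ilc_imp_wsc:
  assumes "identity_limit_criterion N \<phi> \<Omega> F"
  shows "weak_separation_condition N \<phi> F"
proof -
  obtain \<epsilon> where \<epsilon>: "0 < \<epsilon>" "\<And>v w x. v \<in> words N \<Longrightarrow> w \<in> words N \<Longrightarrow> x \<in> F \<Longrightarrow> W v x \<noteq> W w x \<Longrightarrow>
      \<exists>x\<in>F. \<epsilon> * s v \<le> norm (W v x - W w x)"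
    using assms unfolding identity_limit_criterion_iff by blast
  obtain C where C: "0 < C" "\<And>w. w \<in> words N \<Longrightarrow> s w \<le> C * diameter (W w ` F)"
    using s_le_diameter by blast
  \<comment> \<open>Deleting the last letter leaves a diameter above \<open>r\<close>, so every word
    counted at scale \<open>r\<close> satisfies \<open>a * r \<le> s w\<close>.\<close>
  define a where "a = m / (C1\<^sup>2 * \<Delta>)"
  have "0 < a" using pos C1_ge_1 \<Delta>_pos by (simp add: a_def)
  \<comment> \<open>Maps with equal codes differ by less than \<open>4 * \<eta> * r\<close>: twice
    \<open>\<eta> * r\<close> from rounding, twice from moving to a net point. This is half of the
    separation \<open>\<epsilon> * a * r\<close>.\<close>
  define \<eta> where "\<eta> = \<epsilon> * a / 8"
  \<comment> \<open>Lipschitz constants are at most \<open>C * r\<close>, so moving by \<delta>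
    costs at most \<open>\<eta> * r\<close>.\<close>
  define \<delta> where "\<delta> = \<eta> / C"
  have "0 < \<eta>" "0 < \<delta>" using \<epsilon> \<open>0 < a\<close> C by (auto simp: \<eta>_def \<delta>_def)
  obtain E where E: "finite E" "E \<subseteq> F" "F \<subseteq> (\<Union>e\<in>E. ball e \<delta>)"
    using seq_compact_imp_totally_bounded[OF compact_imp_seq_compact[OF compact_F], rule_format, OF \<open>0 < \<delta>\<close>]
    by metis
  \<comment> \<open>Radius 2: an image of diameter at most \<open>r\<close> meeting
    \<open>cball x r\<close> lies within \<open>2 * r\<close> of \<open>x\<close>.\<close>
  obtain T where T: "finite T" "cball (0::'a) 2 \<subseteq> (\<Union>e\<in>T. ball e \<eta>)"
    using seq_compact_imp_totally_bounded[OF compact_imp_seq_compact[OF compact_cball[of "0::'a" 2]], rule_format, OF \<open>0 < \<eta>\<close>]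
    by metis
  have "finite (wsc_maps N \<phi> F x r) \<and> card (wsc_maps N \<phi> F x r) \<le> card (PiE E (\<lambda>_. T))"
    if r: "0 < r" for x r
  proof -
    define S where "S = wsc_maps N \<phi> F x r"
    have Sw: "\<exists>w\<in>words N. h = restrict (W w) F \<and> a * r \<le> s w \<and> s w \<le> C * r \<and> (\<forall>y\<in>F. norm (W w y - x) \<le> 2 * r)"
      if h: "h \<in> S" for h
    proof -
      obtain w where w: "h = restrict (W w) F" "w \<in> words N" "w \<noteq> []"
        "diameter (W w ` F) \<le> r" "r < diameter (W (butlast w) ` F)" "W w ` F \<inter> cball x r \<noteq> {}"
        using h unfolding S_def wsc_maps_def by blast
      have bw: "butlast w \<in> words N" using w(2) by (auto simp: in_lists_conv_set dest: in_set_butlastD)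
      have "s w \<le> C * r" using C w by (meson order_trans mult_left_mono less_imp_le)
      moreover have "a * r \<le> s w"
      proof -
        have "m * r \<le> m * (s (butlast w) * \<Delta>)"
          using w(5) diameter_W_le[OF bw] pos by (intro mult_left_mono) auto
        also have "\<dots> \<le> (C1\<^sup>2 * s w) * \<Delta>"
          using mult_right_mono[OF s_butlast[OF w(2,3)], of \<Delta>] \<Delta>_pos by (simp add: mult_ac)
        finally show ?thesis using C1_ge_1 \<Delta>_pos by (simp add: a_def field_simps)
      qed
      moreover have "norm (W w y - x) \<le> 2 * r" if "y \<in> F" for y
      proof -
        obtain z where z: "z \<in> F" "norm (x - W w z) \<le> r"
          using w(6) by (auto simp: dist_norm)
        have "norm (W w y - x) \<le> norm (W w y - W w z) + norm (x - W w z)" by norm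
        then show ?thesis
          using dist_le_diameter_W[OF w(2) that z(1)] w(4) z(2) by simp
      qed
      ultimately show ?thesis using w by blast
    qed
    define \<tau> where "\<tau> h e = (SOME t. t \<in> T \<and> norm ((1 / r) *\<^sub>R (h e - x) - t) < \<eta>)" for h :: "'a \<Rightarrow> 'a" and e
    have \<tau>: "\<tau> h e \<in> T \<and> norm ((1 / r) *\<^sub>R (h e - x) - \<tau> h e) < \<eta>" if he: "h \<in> S" "e \<in> E" for h e
      unfolding \<tau>_def
    proof (rule someI_ex)
      have "norm (h e - x) \<le> 2 * r" using Sw[OF he(1)] he(2) E by force
      then have "norm (h e - x) / r \<le> 2" using r by (simp add: divide_le_eq)
      then have "(1 / r) *\<^sub>R (h e - x) \<in> cball 0 2" using r by simp
      with T show "\<exists>t. t \<in> T \<and> norm ((1 / r) *\<^sub>R (h e - x) - t) < \<eta>"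
        by (force simp: dist_norm norm_minus_commute)
    qed
    have inj: "inj_on (\<lambda>h. restrict (\<tau> h) E) S"
    proof (rule inj_onI, rule ccontr)
      fix g h assume gh: "g \<in> S" "h \<in> S" "restrict (\<tau> g) E = restrict (\<tau> h) E" "g \<noteq> h"
      obtain v where v: "v \<in> words N" "g = restrict (W v) F" "a * r \<le> s v" "s v \<le> C * r" using Sw[OF gh(1)] by blast
      obtain w where w: "w \<in> words N" "h = restrict (W w) F" "s w \<le> C * r" using Sw[OF gh(2)] by blast
      obtain y where y: "y \<in> F" "\<epsilon> * s v \<le> norm (W v y - W w y)"
        using \<epsilon>(2)[OF v(1) w(1)] gh(4) unfolding v(2) w(2) restrict_eq_iff by blast
      obtain e where e: "e \<in> E" "norm (e - y) < \<delta>" using E y by (auto simp: dist_norm)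
      then have eF: "e \<in> F" "e \<in> \<Omega>" "y \<in> \<Omega>" using E F_dom y by auto
      have "\<tau> g e = \<tau> h e" using gh(3) e by (auto simp: restrict_eq_iff)
      then have "norm ((1 / r) *\<^sub>R (g e - x) - (1 / r) *\<^sub>R (h e - x)) < 2 * \<eta>"
        using \<tau>[OF gh(1) e(1)] \<tau>[OF gh(2) e(1)]
          norm_triangle_ineq4[of "(1 / r) *\<^sub>R (g e - x) - \<tau> g e" "(1 / r) *\<^sub>R (h e - x) - \<tau> g e"] by simp
      also have "(1 / r) *\<^sub>R (g e - x) - (1 / r) *\<^sub>R (h e - x) = (1 / r) *\<^sub>R (W v e - W w e)"
        using v w eF by (simp flip: scaleR_diff_right)
      also have "norm \<dots> = norm (W v e - W w e) / r" using r by simp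
      finally have 1: "norm (W v e - W w e) < 2 * \<eta> * r" using r by (simp add: divide_less_eq)
      have lip: "norm (W u y - W u e) \<le> \<eta> * r" if "u \<in> words N" "s u \<le> C * r" for u
      proof -
        have "norm (W u y - W u e) \<le> s u * norm (y - e)" using W_lipschitz that eF by blast
        also have "\<dots> \<le> (C * r) * \<delta>"
          using that e C r by (intro mult_mono) (auto simp: norm_minus_commute)
        finally show ?thesis using C by (simp add: \<delta>_def mult_ac)
      qed
      have "\<epsilon> * (a * r) \<le> \<epsilon> * s v" using v \<epsilon> by (intro mult_left_mono) auto
      also have "\<dots> \<le> norm (W v y - W w y)" by fact
      also have "\<dots> \<le> norm (W v y - W v e) + norm (W v e - W w e) + norm (W w y - W w e)" by norm
      also have "\<dots> < 4 * \<eta> * r" using 1 lip[OF v(1,4)] lip[OF w(1,3)] by simp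
      finally show False using r \<epsilon> \<open>0 < a\<close> by (simp add: \<eta>_def mult_ac)
    qed
    have sub: "(\<lambda>h. restrict (\<tau> h) E) ` S \<subseteq> PiE E (\<lambda>_. T)" using \<tau> by auto
    have fin: "finite (PiE E (\<lambda>_. T))" using E T by (intro finite_PiE) auto
    show ?thesis
      using inj_on_finite[OF inj sub fin] card_inj_on_le[OF inj sub fin] by (simp add: S_def)
  qed
  then show ?thesis unfolding weak_separation_condition_def by blast
qed

section \<open>Relatively close maps: Lipschitz closeness and disjointness\<close>

text \<open>Closeness to \<open>W v\<close> limits how far \<open>W w\<close> can spread two fixed
  points, while by \<open>W_lower\<close> it spreads them in proportion to \<open>s w\<close>. This
  controls the second map although closeness is measured against \<open>s v\<close> only.\<close>

lemma s_le_of_close: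
  "\<exists>\<delta>>0. \<forall>v\<in>words N. \<forall>w\<in>words N. (\<forall>x\<in>F. norm (W v x - W w x) \<le> \<delta> * s v) \<longrightarrow> s w \<le> 4 * C1 * s v"
proof -
  obtain a b where ab: "a \<in> F" "b \<in> F" "a \<noteq> b" "norm (a - b) \<le> \<rho>"
    using close_points[OF \<rho>_pos] .
  define d where "d = norm (a - b)"
  have "s w \<le> 4 * C1 * s v"
    if vw: "v \<in> words N" "w \<in> words N" and close: "\<forall>x\<in>F. norm (W v x - W w x) \<le> d / 2 * s v" for v w
  proof -
    have "norm (W w a - W w b) \<le> norm (W v a - W v b) + norm (W v a - W w a) + norm (W v b - W w b)"
      by norm
    also have "\<dots> \<le> s v * d + d / 2 * s v + d / 2 * s v"
      unfolding d_def using ab F_dom vw close[unfolded d_def] by (intro add_mono W_lipschitz) auto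
    finally have "norm (W w a - W w b) \<le> 2 * s v * d" by (simp add: algebra_simps)
    then have "2 * C1 * norm (W w a - W w b) \<le> 2 * C1 * (2 * s v * d)"
      using C1_ge_1 by (intro mult_left_mono) auto
    with W_lower[OF vw(2) ab(1,2,4)] have "s w * d \<le> (4 * C1 * s v) * d"
      by (simp add: d_def mult_ac)
    then show ?thesis using ab by (simp add: d_def)
  qed
  then show ?thesis using ab by (intro exI[of _ "d / 2"]) (auto simp: d_def)
qed

text \<open>By compactness: after rescaling, the derivatives of the differences \<open>f\<^sub>n - g\<^sub>n\<close> at \<open>x\<^sub>n\<close> have a limit
  \<open>A0\<close>, and since the limit of the differences vanishes on \<open>F\<close>, \<open>A0\<close> is small on short chords of \<open>F\<close>
  near \<open>x0\<close>, in particular on \<open>y\<^sub>n - x\<^sub>n\<close>.\<close>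

lemma close_imp_lipschitz_close:
  assumes "0 < \<kappa>"
  shows "\<exists>\<delta>>0. \<forall>v\<in>words N. \<forall>w\<in>words N. (\<forall>x\<in>F. norm (W v x - W w x) \<le> \<delta> * s v) \<longrightarrow>
    (\<forall>x\<in>F. \<forall>y\<in>F. norm ((W v y - W w y) - (W v x - W w x)) \<le> \<kappa> * s v * norm (y - x))"
proof (rule ccontr)
  assume contr: "\<not> ?thesis"
  obtain d where d: "0 < d" "\<And>v w. v \<in> words N \<Longrightarrow> w \<in> words N \<Longrightarrow> (\<And>x. x \<in> F \<Longrightarrow> norm (W v x - W w x) \<le> d * s v) \<Longrightarrow> s w \<le> 4 * C1 * s v"
    using s_le_of_close by blast
  \<comment> \<open>Capping by \<open>d\<close> makes the bound on \<open>s (w n)\<close> available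
    for every \<open>n\<close>.\<close>
  define \<delta> where "\<delta> n = min d (1 / real (Suc n))" for n
  have \<delta>: "0 < \<delta> n" "\<delta> n \<le> d" for n using d by (auto simp: \<delta>_def)
  have "\<delta> \<longlonglongrightarrow> min d 0"
    unfolding \<delta>_def by (intro tendsto_intros LIMSEQ_Suc[OF lim_1_over_n])
  then have \<delta>_lim: "\<delta> \<longlonglongrightarrow> 0" using d by simp
  have "\<forall>n. \<exists>v w x y. v \<in> words N \<and> w \<in> words N \<and> (\<forall>x\<in>F. norm (W v x - W w x) \<le> \<delta> n * s v) \<and> x \<in> F \<and> y \<in> F \<and>
      norm ((W v y - W w y) - (W v x - W w x)) > \<kappa> * s v * norm (y - x)"
    using contr \<delta>(1) by (meson not_le)
  then obtain v w x y where
    v: "\<And>n. v n \<in> words N" and w: "\<And>n. w n \<in> words N" and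
    close: "\<And>n z. z \<in> F \<Longrightarrow> norm (W (v n) z - W (w n) z) \<le> \<delta> n * s (v n)" and
    x: "\<And>n. x n \<in> F" and y: "\<And>n. y n \<in> F" and
    far: "\<And>n. norm ((W (v n) (y n) - W (w n) (y n)) - (W (v n) (x n) - W (w n) (x n))) > \<kappa> * s (v n) * norm (y n - x n)"
    by metis
  define S where "S n = s (v n)" for n
  have S: "0 < S n" for n using s_pos v by (simp add: S_def)
  have sw: "s (w n) \<le> 4 * C1 * S n" for n
  proof -
    have "\<delta> n * s (v n) \<le> d * s (v n)"
      using \<delta>(2) less_imp_le[OF s_pos[OF v]] by (rule mult_right_mono)
    then show ?thesis unfolding S_def using close by (intro d(2) v w) (meson order_trans)
  qed
  define e where "e n = norm (y n - x n)" for n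
  \<comment> \<open>Both values of the difference are at most \<open>\<delta> n * S n\<close>, so a
    difference quotient above \<kappa> forces the two points together.\<close>
  have e_le: "e n \<le> 2 / \<kappa> * \<delta> n" for n
  proof -
    have "\<kappa> * S n * e n \<le> norm (W (v n) (y n) - W (w n) (y n)) + norm (W (v n) (x n) - W (w n) (x n))"
      using far[of n] norm_triangle_ineq4 unfolding S_def e_def by (meson less_imp_le order_trans)
    also have "\<dots> \<le> \<delta> n * S n + \<delta> n * S n"
      unfolding S_def by (intro add_mono close x y)
    finally have "\<kappa> * e n * S n \<le> 2 * \<delta> n * S n" by (simp add: mult_ac)
    then show ?thesis using S[of n] assms by (simp add: field_simps)
  qed
  have e_pos: "0 < e n" for n using far[of n] by (cases "x n = y n") (auto simp: e_def)
  have e_lim: "e \<longlonglongrightarrow> 0"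
  proof (rule tendsto_sandwich[OF _ _ tendsto_const])
    show "(\<lambda>n. 2 / \<kappa> * \<delta> n) \<longlonglongrightarrow> 0" by (rule tendsto_mult_right_zero[OF \<delta>_lim])
    show "eventually (\<lambda>n. e n \<le> 2 / \<kappa> * \<delta> n) sequentially" by (intro always_eventually allI e_le)
    show "eventually (\<lambda>n. 0 \<le> e n) sequentially" by (intro always_eventually allI less_imp_le e_pos)
  qed
  \<comment> \<open>Normalized by \<open>S n\<close>, these stay in a fixed ball of a
    finite-dimensional space, so a subsequence converges.\<close>
  define A where "A n = (1 / S n) *\<^sub>R (DW (v n) (x n) - DW (w n) (x n))" for n
  define C where "C = C2 * (1 + 4 * C1)"
  have C: "0 < C" using C2_pos C1_ge_1 by (simp add: C_def)
  have C2_le: "C2 * S n * t + C2 * s (w n) * t \<le> S n * (C * t)" if "0 \<le> t" for t n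
  proof -
    have "C2 * t * s (w n) \<le> C2 * t * (4 * C1 * S n)" 
      using sw[of n] C2_pos that by (intro mult_left_mono) auto
    then show ?thesis by (simp add: C_def algebra_simps)
  qed
  \<comment> \<open>The derivative is frozen at \<open>x n\<close> while the chord joins arbitrary
    points of \<open>F\<close>: the first power pays for the change of base point, the second is the
    Taylor remainder. A chord independent of \<open>n\<close> allows passage to the limit.\<close>
  have taylor: "norm (S n *\<^sub>R A n (z' - z) - ((W (v n) z' - W (w n) z') - (W (v n) z - W (w n) z)))
      \<le> S n * (C * ((norm (x n - z) powr \<alpha> + norm (z' - z) powr \<alpha>) * norm (z' - z)))" (is "norm ?X \<le> _")
    if z: "z \<in> F" "z' \<in> F" for n z z'
  proof -
    let ?h = "z' - z"
    have one: "norm (DW u (x n) ?h - (W u z' - W u z)) \<le> 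
        C2 * s u * ((norm (x n - z) powr \<alpha> + norm ?h powr \<alpha>) * norm ?h)" if u: "u \<in> words N" for u
    proof -
      have "norm ((DW u (x n) - DW u z) ?h) \<le> norm (DW u (x n) - DW u z) * norm ?h"
        by (rule norm_blinfun)
      also have "\<dots> \<le> (C2 * s u * norm (x n - z) powr \<alpha>) * norm ?h"
        using u x z F_dom by (intro mult_right_mono DW_holder) auto
      finally have "norm (DW u (x n) ?h - DW u z ?h) \<le> \<dots>" by (simp only: blinfun.diff_left)
      moreover have "norm (W u z' - W u z - DW u z ?h) \<le> C2 * s u * norm ?h powr \<alpha> * norm ?h"
        using W_taylor u z by blast
      ultimately have "norm (DW u (x n) ?h - (W u z' - W u z)) \<le> 
          (C2 * s u * norm (x n - z) powr \<alpha>) * norm ?h + C2 * s u * norm ?h powr \<alpha> * norm ?h"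
        by (intro norm_diff_triangle_le[of _ "DW u z ?h"]) (simp_all add: norm_minus_commute)
      then show ?thesis by (simp add: algebra_simps)
    qed
    have "S n *\<^sub>R A n ?h = DW (v n) (x n) ?h - DW (w n) (x n) ?h"
      using S[of n] by (simp add: A_def blinfun.scaleR_left blinfun.diff_left)
    then have "?X = (DW (v n) (x n) ?h - (W (v n) z' - W (v n) z)) - (DW (w n) (x n) ?h - (W (w n) z' - W (w n) z))"
      by simp
    then have "norm ?X \<le> norm (DW (v n) (x n) ?h - (W (v n) z' - W (v n) z)) + norm (DW (w n) (x n) ?h - (W (w n) z' - W (w n) z))"
      using norm_triangle_ineq4 by metis
    also have "\<dots> \<le> S n * (C * ((norm (x n - z) powr \<alpha> + norm ?h powr \<alpha>) * norm ?h))"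
      using one[OF v] one[OF w] by (intro order_trans[OF add_mono C2_le]) (auto simp: S_def)
    finally show ?thesis .
  qed
  have "norm (A n) \<le> 1 + 4 * C1" for n
  proof -
    have "norm (DW (v n) (x n) - DW (w n) (x n)) \<le> norm (DW (v n) (x n)) + norm (DW (w n) (x n))"
      by (rule norm_triangle_ineq4)
    also have "\<dots> \<le> S n + 4 * C1 * S n"
    proof (intro add_mono)
      have "x n \<in> \<Omega>" using x F_dom by blast
      then show "norm (DW (v n) (x n)) \<le> S n" "norm (DW (w n) (x n)) \<le> 4 * C1 * S n"
        using norm_DW_le_s[OF v, of "x n" n] norm_DW_le_s[OF w, of "x n" n] sw[of n] by (auto simp: S_def)
    qed
    finally have "norm (DW (v n) (x n) - DW (w n) (x n)) / S n \<le> 1 + 4 * C1"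
      using S[of n] by (simp add: divide_le_eq algebra_simps)
    then show ?thesis using S[of n] by (simp add: A_def)
  qed
  then have "\<forall>n. (x n, A n) \<in> F \<times> cball 0 (1 + 4 * C1)" using x by simp
  moreover have "compact (F \<times> cball (0::'a \<Rightarrow>\<^sub>L 'a) (1 + 4 * C1))"
    by (intro compact_Times compact_F compact_cball)
  ultimately obtain p r where p: "p \<in> F \<times> cball 0 (1 + 4 * C1)" "strict_mono r" "((\<lambda>n. (x n, A n)) \<circ> r) \<longlonglongrightarrow> p"
    unfolding compact_def by (metis (no_types, lifting))
  define x0 A0 where "x0 = fst p" "A0 = snd p"
  have xr: "(\<lambda>n. x (r n)) \<longlonglongrightarrow> x0" and Ar: "(\<lambda>n. A (r n)) \<longlonglongrightarrow> A0"
    using tendsto_fst[OF p(3)] tendsto_snd[OF p(3)] by (auto simp: x0_A0_def o_def)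
  have \<delta>r: "(\<lambda>n. \<delta> (r n)) \<longlonglongrightarrow> 0" and er: "(\<lambda>n. e (r n)) \<longlonglongrightarrow> 0"
    using LIMSEQ_subseq_LIMSEQ[OF \<delta>_lim p(2)] LIMSEQ_subseq_LIMSEQ[OF e_lim p(2)] by (auto simp: o_def)
  \<comment> \<open>For a fixed chord the differences at both ends vanish in the limit, leaving only
    the Hoelder error.\<close>
  have A0: "norm (A0 (z' - z)) \<le> C * ((norm (x0 - z) powr \<alpha> + norm (z' - z) powr \<alpha>) * norm (z' - z))"
    if z: "z \<in> F" "z' \<in> F" for z z'
  proof (rule LIMSEQ_le)
    show "(\<lambda>n. norm (A (r n) (z' - z))) \<longlonglongrightarrow> norm (A0 (z' - z))"
      by (intro tendsto_intros Ar)
    have "(\<lambda>n. 2 * \<delta> (r n) + C * ((norm (x (r n) - z) powr \<alpha> + norm (z' - z) powr \<alpha>) * norm (z' - z)))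
      \<longlonglongrightarrow> 2 * 0 + C * ((norm (x0 - z) powr \<alpha> + norm (z' - z) powr \<alpha>) * norm (z' - z))"
      using pos by (intro tendsto_intros tendsto_powr' xr \<delta>r) auto
    then show "(\<lambda>n. 2 * \<delta> (r n) + C * ((norm (x (r n) - z) powr \<alpha> + norm (z' - z) powr \<alpha>) * norm (z' - z)))
      \<longlonglongrightarrow> C * ((norm (x0 - z) powr \<alpha> + norm (z' - z) powr \<alpha>) * norm (z' - z))" by simp
    have "norm (A n (z' - z)) \<le> 2 * \<delta> n + C * ((norm (x n - z) powr \<alpha> + norm (z' - z) powr \<alpha>) * norm (z' - z))" for n
    proof -
      let ?R = "S n * (C * ((norm (x n - z) powr \<alpha> + norm (z' - z) powr \<alpha>) * norm (z' - z)))"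
      have "norm a \<le> norm p + norm q + norm (a - (p - q))" for a p q :: 'a by norm
      then have "norm (S n *\<^sub>R A n (z' - z)) \<le> \<delta> n * S n + \<delta> n * S n + ?R"
        using taylor[OF z, of n] close[OF z(1), of n] close[OF z(2), of n] unfolding S_def[symmetric]
        by (meson add_mono order_trans)
      also have "\<dots> = S n * (2 * \<delta> n + C * ((norm (x n - z) powr \<alpha> + norm (z' - z) powr \<alpha>) * norm (z' - z)))"
        by (simp add: algebra_simps)
      finally show ?thesis using S[of n] by simp
    qed
    then show "\<exists>N. \<forall>n\<ge>N. norm (A (r n) (z' - z)) \<le> 2 * \<delta> (r n) + C * ((norm (x (r n) - z) powr \<alpha> + norm (z' - z) powr \<alpha>) * norm (z' - z))"
      by blast
  qed
  \<comment> \<open>The limit bound is now applied to the moving chord from \<open>x n\<close> to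
    \<open>y n\<close> and divided by \<open>e n\<close>. One \<open>e n powr \<alpha>\<close> comes
    from \<open>taylor\<close>, the other from \<open>A0\<close>; everything on the right vanishes
    along the subsequence.\<close>
  have \<kappa>_le: "\<kappa> \<le> C * norm (x0 - x n) powr \<alpha> + 2 * C * e n powr \<alpha> + norm (A n - A0)" for n
  proof -
    let ?h = "y n - x n"
    have "\<kappa> * S n * e n \<le> norm (S n *\<^sub>R A n ?h) + S n * (C * ((norm (x n - x n) powr \<alpha> + norm ?h powr \<alpha>) * norm ?h))"
      using taylor[OF x y, of n n n] far[of n] norm_triangle_sub[of "(W (v n) (y n) - W (w n) (y n)) - (W (v n) (x n) - W (w n) (x n))" "S n *\<^sub>R A n ?h"]
      unfolding S_def[symmetric] e_def[symmetric] by (simp add: norm_minus_commute)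
    also have "\<dots> = S n * (norm (A n ?h) + C * e n powr \<alpha> * e n)"
      using S[of n] by (simp add: e_def algebra_simps)
    finally have "S n * (\<kappa> * e n) \<le> \<dots>" by (simp add: mult_ac)
    then have "\<kappa> * e n \<le> norm (A n ?h) + C * e n powr \<alpha> * e n" using S[of n] by simp
    also have "norm (A n ?h) \<le> norm ((A n - A0) ?h) + norm (A0 ?h)"
      by (metis add_diff_cancel_right' blinfun.diff_left diff_add_cancel norm_triangle_ineq)
    also have "norm ((A n - A0) ?h) \<le> norm (A n - A0) * e n" unfolding e_def by (rule norm_blinfun)
    also have "norm (A0 ?h) \<le> C * ((norm (x0 - x n) powr \<alpha> + e n powr \<alpha>) * e n)"
      unfolding e_def by (intro A0 x y)
    finally have "\<kappa> * e n \<le> (C * norm (x0 - x n) powr \<alpha> + 2 * C * e n powr \<alpha> + norm (A n - A0)) * e n"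
      by (simp add: algebra_simps)
    then show ?thesis using e_pos[of n] by simp
  qed
  have "(\<lambda>n. C * norm (x0 - x (r n)) powr \<alpha> + 2 * C * e (r n) powr \<alpha> + norm (A (r n) - A0))
      \<longlonglongrightarrow> C * norm (x0 - x0) powr \<alpha> + 2 * C * 0 powr \<alpha> + norm (A0 - A0)"
    using pos less_imp_le[OF e_pos] by (intro tendsto_intros tendsto_powr' xr er Ar) auto
  then have "(\<lambda>n. C * norm (x0 - x (r n)) powr \<alpha> + 2 * C * e (r n) powr \<alpha> + norm (A (r n) - A0)) \<longlonglongrightarrow> 0"
    using pos by simp
  then have "\<kappa> \<le> 0" by (rule LIMSEQ_le_const) (use \<kappa>_le in blast)
  with assms show False by simp
qed

text \<open>The difference of the two maps is almost constant on a piece around its maximum whose size is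
  much larger than the maximum itself.\<close>

lemma close_and_disjoint:
  assumes "\<not> identity_limit_criterion N \<phi> \<Omega> F" "0 < \<kappa>"
  obtains v w where "v \<in> words N" "w \<in> words N"
    "\<And>x. x \<in> F \<Longrightarrow> norm (W v x - W w x) \<le> \<kappa> * s v" "\<And>x. x \<in> F \<Longrightarrow> W v x \<noteq> W w x"
proof -
  \<comment> \<open>Appending \<open>u\<close> loses \<open>C1\<^sup>2\<close> in
    \<open>word_at_scale\<close> and \<open>C1\<^sup>2\<close> in \<open>s_append_ge\<close>; with
    this \<mu> the final relative distance is exactly \<kappa>.\<close>
  define \<mu> where "\<mu> = \<kappa> * m / (2 * \<Delta> * C1 ^ 4)"
  have "0 < \<mu>" using assms pos \<Delta>_pos C1_ge_1 by (simp add: \<mu>_def)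
  then obtain \<delta> where \<delta>: "0 < \<delta>" "\<And>v w x y. v \<in> words N \<Longrightarrow> w \<in> words N \<Longrightarrow>
      (\<And>x. x \<in> F \<Longrightarrow> norm (W v x - W w x) \<le> \<delta> * s v) \<Longrightarrow> x \<in> F \<Longrightarrow> y \<in> F \<Longrightarrow>
      norm ((W v y - W w y) - (W v x - W w x)) \<le> \<mu> * s v * norm (y - x)"
    using close_imp_lipschitz_close by meson
  \<comment> \<open>The first entry gives access to the Lipschitz bound, the second ensures
    \<open>t \<le> 1\<close>.\<close>
  define \<epsilon> where "\<epsilon> = min \<delta> (2 * \<mu> * \<Delta>)"
  have "0 < \<epsilon>" using \<delta> \<open>0 < \<mu>\<close> \<Delta>_pos by (simp add: \<epsilon>_def)
  then obtain v w z where vw: "v \<in> words N" "w \<in> words N" "z \<in> F" "W v z \<noteq> W w z"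
      "\<And>x. x \<in> F \<Longrightarrow> norm (W v x - W w x) < \<epsilon> * s v"
    using assms(1) unfolding identity_limit_criterion_iff by (metis not_le)
  have sv: "0 < s v" using s_pos vw by blast
  obtain x0 where x0: "x0 \<in> F" "\<And>y. y \<in> F \<Longrightarrow> norm (W v y - W w y) \<le> norm (W v x0 - W w x0)"
    using difference_attains_sup[OF vw(1,2)] by metis
  define e where "e = norm (W v x0 - W w x0) / s v"
  have "0 < norm (W v x0 - W w x0)" using x0(2)[OF vw(3)] vw(4) by (smt (verit) zero_less_norm_iff right_minus_eq)
  then have e: "0 < e" "e < \<epsilon>" using vw(5)[OF x0(1)] sv by (auto simp: e_def field_simps)
  \<comment> \<open>On a piece of size \<open>t * \<Delta>\<close> the difference varies by at most
    \<open>\<mu> * s v * (t * \<Delta>)\<close>, which is half of its maximum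
    \<open>e * s v\<close>.\<close>
  define t where "t = e / (2 * \<mu> * \<Delta>)"
  have t: "0 < t" "t \<le> 1"
    using e \<open>0 < \<mu>\<close> \<Delta>_pos by (auto simp: t_def \<epsilon>_def)
  obtain u where u: "u \<in> words N" "x0 \<in> W u ` F" "s u \<le> t" "m * t \<le> C1\<^sup>2 * s u"
    using word_at_scale[OF x0(1) t] .
  have le: "norm (W (v @ u) x - W (w @ u) x) \<le> \<kappa> * s (v @ u)" if "x \<in> F" for x
  proof -
    have "norm (W (v @ u) x - W (w @ u) x) \<le> e * s v"
      using x0(2)[OF W_F[OF u(1) that]] sv by (simp add: word_map_append e_def)
    also have "\<dots> = (2 * \<mu> * \<Delta> / m) * (m * t) * s v"
      using \<open>0 < \<mu>\<close> \<Delta>_pos pos by (simp add: t_def)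
    also have "\<dots> \<le> (2 * \<mu> * \<Delta> / m) * (C1\<^sup>2 * s u) * s v"
      using u \<open>0 < \<mu>\<close> \<Delta>_pos pos sv by (intro mult_right_mono mult_left_mono) auto
    also have "\<dots> = (2 * \<mu> * \<Delta> / m) * C1\<^sup>2 * (s v * s u)" by simp
    also have "\<dots> \<le> (2 * \<mu> * \<Delta> / m) * C1\<^sup>2 * (C1\<^sup>2 * s (v @ u))"
      using \<open>0 < \<mu>\<close> \<Delta>_pos pos vw u by (intro mult_left_mono s_append_ge) auto
    also have "\<dots> = \<kappa> * s (v @ u)"
      using \<Delta>_pos pos C1_ge_1 by (simp add: \<mu>_def power2_eq_square power4_eq_xxxx)
    finally show ?thesis .
  qed
  \<comment> \<open>The piece of \<open>u\<close> contains both \<open>x0\<close> and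
    \<open>W u x\<close>, so a coincidence there would bound the positive maximum by half of
    itself.\<close>
  have ne: "W (v @ u) x \<noteq> W (w @ u) x" if "x \<in> F" for x
  proof
    assume eq: "W (v @ u) x = W (w @ u) x"
    obtain y where y: "y \<in> F" "x0 = W u y" using u by blast
    have close: "norm (W v x - W w x) \<le> \<delta> * s v" if "x \<in> F" for x
    proof -
      have "\<epsilon> * s v \<le> \<delta> * s v" using sv by (intro mult_right_mono) (auto simp: \<epsilon>_def)
      then show ?thesis using vw(5)[OF that] by simp
    qed
    have "W v (W u x) - W w (W u x) = 0" using eq unfolding word_map_append by simp
    then have "e * s v = norm ((W v x0 - W w x0) - (W v (W u x) - W w (W u x)))"
      unfolding e_def using sv by simp
    also have "\<dots> \<le> \<mu> * s v * norm (x0 - W u x)"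
      using \<delta>(2)[OF vw(1,2) close W_F[OF u(1) that] x0(1)] .
    also have "\<dots> \<le> \<mu> * s v * (t * \<Delta>)"
    proof (rule mult_left_mono)
      have "norm (x0 - W u x) \<le> s u * norm (y - x)"
        unfolding y(2) using y(1) that F_dom by (intro W_lipschitz u) auto
      also have "\<dots> \<le> t * \<Delta>"
      proof (rule mult_mono)
        show "norm (y - x) \<le> \<Delta>" using y(1) that F_dom by (intro dist_dom) auto
      qed (use u(3) t(1) in auto)
      finally show "norm (x0 - W u x) \<le> t * \<Delta>" .
    qed (use \<open>0 < \<mu>\<close> sv in simp)
    also have "\<dots> = e * s v / 2" using \<open>0 < \<mu>\<close> \<Delta>_pos by (simp add: t_def)
    finally show False using e sv by simp
  qed
  show thesis using that[of "v @ u" "w @ u"] le ne vw u by simp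
qed

section \<open>Large families of close maps contradict weak separation\<close>

text \<open>Prepending \<open>f\<close> keeps the family distinct by injectivity and close by the
  Lipschitz bound. The added \<open>f' @ h\<close> differs from \<open>f @ h\<close> since
  \<open>f\<close> and \<open>f'\<close> agree nowhere on \<open>F\<close>, and from the other
  \<open>f @ w\<close> since it is too close to \<open>f @ h\<close>. The new centre is
  \<open>f @ h\<close>.\<close>

lemma many_close_words:
  assumes "\<not> identity_limit_criterion N \<phi> \<Omega> F" "0 < \<delta>"
  shows "\<exists>A h. A \<subseteq> words N \<and> finite A \<and> card A = Suc k \<and> h \<in> A \<and>
    inj_on (\<lambda>w. restrict (W w) F) A \<and> (\<forall>w\<in>A. \<forall>x\<in>F. norm (W w x - W h x) \<le> \<delta> * s h)"
  using assms(2)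
proof (induction k arbitrary: \<delta>)
  case 0
  then show ?case
    by (intro exI[of _ "{[]}"] exI[of _ "[]"]) (auto simp del: word_map.simps intro!: mult_nonneg_nonneg less_imp_le[OF s_pos])
next
  case (Suc k)
  \<comment> \<open>Dividing by \<open>C1\<^sup>2\<close> offsets the loss in
    \<open>s_append_ge\<close>; the cap \<rho> lets \<open>W_lower\<close> apply to the points
    \<open>W w x\<close> and \<open>W h x\<close>, as \<open>s h \<le> 1\<close>.\<close>
  define \<delta>' where "\<delta>' = min (\<delta> / C1\<^sup>2) \<rho>"
  have "0 < \<delta>'" using Suc.prems C1_ge_1 \<rho>_pos by (auto simp: \<delta>'_def)
  then obtain A h where A: "A \<subseteq> words N" "finite A" "card A = Suc k" "h \<in> A"
    "inj_on (\<lambda>w. restrict (W w) F) A"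
    and close: "\<And>w x. w \<in> A \<Longrightarrow> x \<in> F \<Longrightarrow> norm (W w x - W h x) \<le> \<delta>' * s h"
    using Suc.IH[of \<delta>'] by metis
  have h: "h \<in> words N" using A by blast
  have "\<forall>w\<in>A - {h}. \<exists>y\<in>F. W w y \<noteq> W h y"
    using inj_onD[OF A(5)] A(4) unfolding restrict_eq_iff by blast
  then obtain y where y: "\<And>w. w \<in> A - {h} \<Longrightarrow> y w \<in> F \<and> W w (y w) \<noteq> W h (y w)" by metis
  define g where "g w = norm (W w (y w) - W h (y w))" for w
  \<comment> \<open>The first entry keeps \<open>f' @ h\<close> near the new centre. The others
    place the distance of \<open>f\<close> and \<open>f'\<close> below the separation that
    \<open>f\<close> preserves between \<open>w\<close> and \<open>h\<close> at the witness
    \<open>y w\<close>.\<close>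
  define \<beta> where "\<beta> = Min (insert (\<delta> * s h / C1\<^sup>2) ((\<lambda>w. g w / (2 * C1)) ` (A - {h})))"
  have "0 < \<beta>" unfolding \<beta>_def
    using A Suc.prems s_pos[OF h] C1_ge_1 y by (subst Min_gr_iff) (auto simp: g_def)
  have \<beta>_le: "\<beta> \<le> \<delta> * s h / C1\<^sup>2" "\<And>w. w \<in> A - {h} \<Longrightarrow> \<beta> \<le> g w / (2 * C1)"
    unfolding \<beta>_def using A by (auto intro!: Min_le)
  obtain f f' where f: "f \<in> words N" "f' \<in> words N"
    "\<And>x. x \<in> F \<Longrightarrow> norm (W f x - W f' x) \<le> \<beta> / 2 * s f" "\<And>x. x \<in> F \<Longrightarrow> W f x \<noteq> W f' x"
    using close_and_disjoint[OF assms(1), of "\<beta> / 2"] \<open>0 < \<beta>\<close> by (metis half_gt_zero)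
  have sf: "0 < s f" and sh: "0 < s h" using s_pos f h by auto
  have dom: "W w x \<in> F" if "w \<in> A" "x \<in> F" for w x
    using that A W_F by blast
  have new: "W (f' @ h) x \<noteq> W (f @ w) x" if w: "w \<in> A" "x = (if w = h then x else y w)" "x \<in> F" for w x
  proof (cases "w = h")
    case True
    then show ?thesis using f(4)[OF dom[OF A(4) w(3)]] by (simp add: word_map_append)
  next
    case False
    then have x: "x = y w" and w': "w \<in> A - {h}" using w by auto
    have "norm (W w x - W h x) \<le> \<delta>' * s h" using close w by blast
    also have "\<dots> \<le> \<rho> * 1"
      using s_le_power[OF h] power_le_one[of lam "length h"] pos lam_less_1 sh \<rho>_pos
      by (intro mult_mono) (auto simp: \<delta>'_def)
    finally have "s f * g w \<le> 2 * C1 * norm (W f (W w x) - W f (W h x))"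
      using W_lower[OF f(1) dom[OF w(1,3)] dom[OF A(4) w(3)]] by (simp add: g_def x)
    moreover have "2 * C1 * \<beta> \<le> g w"
      using \<beta>_le(2)[OF w'] C1_ge_1 by (simp add: field_simps)
    then have "s f * (2 * C1 * \<beta>) \<le> s f * g w" using sf by simp
    ultimately have "2 * C1 * (\<beta> * s f) \<le> 2 * C1 * norm (W f (W w x) - W f (W h x))"
      by (simp add: mult_ac)
    then have "\<beta> * s f \<le> norm (W f (W w x) - W f (W h x))" using C1_ge_1 by simp
    moreover have "norm (W f (W h x) - W f' (W h x)) \<le> \<beta> / 2 * s f"
      using f dom A w by blast
    moreover have "\<beta> / 2 * s f < \<beta> * s f" using \<open>0 < \<beta>\<close> sf by simp
    ultimately have "W f' (W h x) \<noteq> W f (W w x)" by (auto simp only: norm_minus_commute)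
    then show ?thesis by (simp add: word_map_append)
  qed
  have new': "restrict (W (f' @ h)) F \<noteq> restrict (W (f @ w)) F" if "w \<in> A" for w
  proof -
    obtain z where "z \<in> F" using F_nonempty by blast
    then show ?thesis
      using new[OF that, of "if w = h then z else y w"] y[of w] that
      unfolding restrict_eq_iff by (cases "w = h") auto
  qed
  let ?B = "insert (f' @ h) ((@) f ` A)"
  have notin: "f' @ h \<notin> (@) f ` A" 
  proof
    assume "f' @ h \<in> (@) f ` A"
    then obtain w where "w \<in> A" "f' @ h = f @ w" by (elim imageE)
    then show False using new'[of w] by simp
  qed
  have inj: "inj_on (\<lambda>w. restrict (W w) F) ((@) f ` A)"
  proof (rule inj_onI)
    fix a b assume ab: "a \<in> (@) f ` A" "b \<in> (@) f ` A" "restrict (W a) F = restrict (W b) F"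
    obtain v w where vw: "v \<in> A" "w \<in> A" "a = f @ v" "b = f @ w" using ab(1,2) by blast
    have "W v x = W w x" if "x \<in> F" for x
    proof (rule inj_onD[OF inj_on_W[OF f(1)]])
      show "W f (W v x) = W f (W w x)"
        using ab(3) that unfolding vw(3,4) restrict_eq_iff word_map_append by blast
      show "W v x \<in> \<Omega>" "W w x \<in> \<Omega>" using dom vw that F_dom by blast+
    qed
    then have "v = w" by (intro inj_onD[OF A(5)] vw(1,2)) (simp add: restrict_eq_iff)
    then show "a = b" using vw by simp
  qed
  have dist1: "norm (W (f @ w) x - W (f @ h) x) \<le> \<delta> * s (f @ h)" if w: "w \<in> A" "x \<in> F" for w x
  proof -
    have "norm (W (f @ w) x - W (f @ h) x) \<le> s f * norm (W w x - W h x)"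
      unfolding word_map_append using dom w A(4) F_dom by (intro W_lipschitz f) blast+
    also have "\<dots> \<le> s f * (\<delta>' * s h)" using close[OF w] sf by (intro mult_left_mono) auto
    also have "\<dots> \<le> s f * (\<delta> / C1\<^sup>2 * s h)" using sf sh
      by (intro mult_left_mono mult_right_mono) (auto simp: \<delta>'_def)
    also have "\<dots> = \<delta> / C1\<^sup>2 * (s f * s h)" by simp
    also have "\<dots> \<le> \<delta> / C1\<^sup>2 * (C1\<^sup>2 * s (f @ h))"
      using Suc.prems f h by (intro mult_left_mono s_append_ge) auto
    also have "\<dots> = \<delta> * s (f @ h)" using C1_ge_1 by simp
    finally show ?thesis .
  qed
  have dist2: "norm (W (f' @ h) x - W (f @ h) x) \<le> \<delta> * s (f @ h)" if x: "x \<in> F" for x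
  proof -
    have "norm (W (f' @ h) x - W (f @ h) x) \<le> \<beta> / 2 * s f"
      using f(3)[OF dom[OF A(4) x]] by (simp add: word_map_append norm_minus_commute)
    also have "\<dots> \<le> (\<delta> * s h / C1\<^sup>2) * s f"
    proof (rule mult_right_mono)
      show "\<beta> / 2 \<le> \<delta> * s h / C1\<^sup>2" using \<beta>_le(1) \<open>0 < \<beta>\<close> by linarith
    qed (use sf in simp)
    also have "\<dots> = \<delta> / C1\<^sup>2 * (s f * s h)" by simp
    also have "\<dots> \<le> \<delta> / C1\<^sup>2 * (C1\<^sup>2 * s (f @ h))"
      using Suc.prems f h by (intro mult_left_mono s_append_ge) auto
    also have "\<dots> = \<delta> * s (f @ h)" using C1_ge_1 by simp
    finally show ?thesis .
  qed
  have "card ?B = Suc (Suc k)"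
    using notin A by (simp add: card_image inj_on_def)
  moreover have "inj_on (\<lambda>w. restrict (W w) F) ?B"
  proof -
    have "restrict (W (f' @ h)) F \<notin> (\<lambda>w. restrict (W (f @ w)) F) ` A"
    proof
      assume "restrict (W (f' @ h)) F \<in> (\<lambda>w. restrict (W (f @ w)) F) ` A"
      then obtain w where "w \<in> A" "restrict (W (f' @ h)) F = restrict (W (f @ w)) F" by (elim imageE)
      then show False using new'[of w] by simp
    qed
    then show ?thesis using inj notin by (simp add: inj_on_insert image_image)
  qed
  moreover have "?B \<subseteq> words N"
    using A(1) f(1,2) h unfolding insert_subset image_subset_iff append_in_lists_conv by blast
  moreover have "\<forall>w\<in>?B. \<forall>x\<in>F. norm (W w x - W (f @ h) x) \<le> \<delta> * s (f @ h)"
    using dist1 dist2 by blast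
  moreover have "finite ?B" "f @ h \<in> ?B" using A by auto
  ultimately show ?case by (intro exI[of _ ?B] exI[of _ "f @ h"] conjI)
qed

text \<open>A word with image of diameter about \<open>r\<close> has a prefix that is empty or contributes to \<open>\<Phi>(x, r)\<close>,
  followed by a suffix of bounded length.\<close>

lemma wsc_bounded_count:
  assumes "weak_separation_condition N \<phi> F"
  shows "\<exists>K. \<forall>A x r. A \<subseteq> words N \<longrightarrow> inj_on (\<lambda>w. restrict (W w) F) A \<longrightarrow> x \<in> F \<longrightarrow> 0 < r \<longrightarrow>
    (\<forall>w\<in>A. r / 3 \<le> diameter (W w ` F) \<and> diameter (W w ` F) \<le> r \<and> W w ` F \<inter> cball x r \<noteq> {}) \<longrightarrow> card A \<le> K"
proof -
  obtain K where K: "\<And>x r. x \<in> F \<Longrightarrow> 0 < r \<Longrightarrow> finite (wsc_maps N \<phi> F x r) \<and> card (wsc_maps N \<phi> F x r) \<le> K"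
    using assms unfolding weak_separation_condition_def by blast
  obtain C where C: "0 < C" "\<And>w. w \<in> words N \<Longrightarrow> s w \<le> C * diameter (W w ` F)"
    using s_le_diameter by blast
  \<comment> \<open>\<open>L\<close> bounds the suffix length: the suffix only has to bridge the
    bounded ratio between the scales of prefix and word.\<close>
  obtain L where L: "lam ^ L < 1 / (3 * C * \<Delta>)"
    using real_arch_pow_inv[of "1 / (3 * C * \<Delta>)" lam] C \<Delta>_pos lam_less_1 by auto
  define U where "U = {u. set u \<subseteq> {1..N} \<and> length u \<le> L}"
  have "finite U" unfolding U_def by (rule finite_lists_length_le) simp
  have "card A \<le> Suc K * card U"
    if A: "A \<subseteq> words N" "inj_on (\<lambda>w. restrict (W w) F) A" and xr: "x \<in> F" "0 < r"
      and d: "\<And>w. w \<in> A \<Longrightarrow> r / 3 \<le> diameter (W w ` F) \<and> diameter (W w ` F) \<le> r \<and> W w ` F \<inter> cball x r \<noteq> {}"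
    for A x r
  proof -
    \<comment> \<open>\<Phi>(x,r) contains only non-empty words, so the identity is added for an
      empty prefix; hence \<open>Suc K\<close>.\<close>
    define P where "P = insert (restrict (W []) F) (wsc_maps N \<phi> F x r)"
    have P: "finite P" "card P \<le> Suc K"
      using K[OF xr] by (auto simp: P_def card_insert_if)
    have "(\<lambda>w. restrict (W w) F) ` A \<subseteq> (\<lambda>(h, u). restrict (h \<circ> W u) F) ` (P \<times> U)"
    proof (rule image_subsetI)
      fix w assume "w \<in> A"
      then have w: "w \<in> words N" "r / 3 \<le> diameter (W w ` F)" "diameter (W w ` F) \<le> r" "W w ` F \<inter> cball x r \<noteq> {}"
        using A d by auto
      \<comment> \<open>Stopping at the first prefix of diameter at most \<open>r\<close> makes the
        diameter of its parent exceed \<open>r\<close>, as membership in \<Phi>(x,r)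
        requires.\<close>
      define n where "n = (LEAST n. diameter (W (take n w) ` F) \<le> r)"
      define p u where "p = take n w" and "u = drop n w"
      have pu: "w = p @ u" "p \<in> words N" "u \<in> words N"
        using w(1) unfolding p_def u_def by (auto simp: in_lists_conv_set dest: in_set_takeD in_set_dropD)
      have dp: "diameter (W p ` F) \<le> r"
        unfolding p_def n_def by (rule LeastI[of _ "length w"]) (simp add: w)
      have "restrict (W p) F \<in> P"
      proof (cases "p = []")
        case False
        have "n \<le> length w" unfolding n_def by (rule Least_le) (simp add: w)
        then have bp: "butlast p = take (n - 1) w" by (simp add: p_def butlast_take)
        have "n \<noteq> 0" using False by (auto simp: p_def)
        then have "\<not> diameter (W (butlast p) ` F) \<le> r"
          unfolding bp n_def by (intro not_less_Least) (simp add: n_def[symmetric])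
        moreover have "W w ` F \<subseteq> W p ` F"
          using pu W_F[OF pu(3)] by (auto simp: word_map_append)
        ultimately have "restrict (W p) F \<in> wsc_maps N \<phi> F x r"
          unfolding wsc_maps_def using False pu(2) dp w(4) by (intro CollectI exI[of _ p]) auto
        then show ?thesis by (simp add: P_def)
      qed (simp add: P_def)
      moreover have "u \<in> U"
      proof -
        have "r / 3 \<le> s w * \<Delta>" using w(2) diameter_W_le[OF w(1)] by simp
        also have "\<dots> \<le> (s p * s u) * \<Delta>"
          using s_append_le[OF pu(2,3)] pu(1) \<Delta>_pos by (intro mult_right_mono) auto
        also have "\<dots> \<le> ((C * r) * lam ^ length u) * \<Delta>"
        proof (intro mult_right_mono mult_mono)
          show "s p \<le> C * r" using C(2)[OF pu(2)] dp C(1) by (meson mult_left_mono less_imp_le order_trans)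
          show "s u \<le> lam ^ length u" using s_le_power pu by blast
        qed (use C xr \<Delta>_pos less_imp_le[OF s_pos[OF pu(3)]] in auto)
        finally have "1 / (3 * C * \<Delta>) \<le> lam ^ length u"
          using C xr \<Delta>_pos by (simp add: field_simps)
        with L have "lam ^ L < lam ^ length u" by simp
        then have "length u < L" using pos lam_less_1 by (simp add: power_strict_decreasing_iff)
        then show ?thesis using pu by (auto simp: U_def)
      qed
      \<comment> \<open>Since \<open>W u\<close> maps \<open>F\<close> into \<open>F\<close>, the
        values of \<open>W p\<close> on \<open>F\<close> determine the composition.\<close>
      moreover have "restrict (W w) F = restrict (restrict (W p) F \<circ> W u) F"
        using pu W_F[OF pu(3)] by (auto simp: restrict_eq_iff word_map_append)
      ultimately show "restrict (W w) F \<in> (\<lambda>(h, u). restrict (h \<circ> W u) F) ` (P \<times> U)"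
        by (intro image_eqI[of _ _ "(restrict (W p) F, u)"]) auto
    qed
    then have "card ((\<lambda>w. restrict (W w) F) ` A) \<le> card (P \<times> U)"
      using P \<open>finite U\<close> by (intro surj_card_le) auto
    also have "\<dots> \<le> Suc K * card U"
      using P by (simp add: card_cartesian_product del: mult_Suc)
    finally show ?thesis using card_image[OF A(2)] by simp
  qed
  then show ?thesis by (intro exI[of _ "Suc K * card U"]) blast
qed

lemma wsc_imp_ilc:
  assumes "weak_separation_condition N \<phi> F"
  shows "identity_limit_criterion N \<phi> \<Omega> F"
proof (rule ccontr)
  assume not_ilc: "\<not> identity_limit_criterion N \<phi> \<Omega> F"
  obtain K where K: "\<And>A x r. A \<subseteq> words N \<Longrightarrow> inj_on (\<lambda>w. restrict (W w) F) A \<Longrightarrow> x \<in> F \<Longrightarrow> 0 < r \<Longrightarrow>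
    (\<And>w. w \<in> A \<Longrightarrow> r / 3 \<le> diameter (W w ` F) \<and> diameter (W w ` F) \<le> r \<and> W w ` F \<inter> cball x r \<noteq> {}) \<Longrightarrow> card A \<le> K"
    using wsc_bounded_count[OF assms] by meson
  obtain C where C: "0 < C" "\<And>w. w \<in> words N \<Longrightarrow> s w \<le> C * diameter (W w ` F)"
    using s_le_diameter by blast
  \<comment> \<open>With this tolerance all maps differ from the central one by at most
    \<open>d / 4\<close>.\<close>
  obtain A h where A: "A \<subseteq> words N" "finite A" "card A = Suc K" "h \<in> A"
    "inj_on (\<lambda>w. restrict (W w) F) A"
    and close: "\<And>w x. w \<in> A \<Longrightarrow> x \<in> F \<Longrightarrow> norm (W w x - W h x) \<le> 1 / (4 * C) * s h"
    using many_close_words[OF not_ilc, of "1 / (4 * C)" K] C by auto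
  have h: "h \<in> words N" using A by blast
  define d where "d = diameter (W h ` F)"
  have "0 < d" using diameter_W_pos h by (simp add: d_def)
  have "1 / (4 * C) * s h \<le> d / 4"
    using C(2)[OF h] C(1) by (simp add: d_def field_simps)
  then have close': "norm (W w x - W h x) \<le> d / 4" if "w \<in> A" "x \<in> F" for w x
    using close[OF that] by simp
  obtain z where z: "z \<in> F" using F_nonempty by blast
  have "card A \<le> K"
  \<comment> \<open>A perturbation by \<open>d / 4\<close> changes diameters by at most
    \<open>d / 2\<close>, so they lie between \<open>d / 2\<close> and \<open>3 / 2 * d\<close>,
    that is, between \<open>r / 3\<close> and \<open>r\<close>.\<close>
  proof (rule K[of A "W h z" "3 / 2 * d"])
    fix w assume w: "w \<in> A"
    then have "w \<in> words N" using A by blast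
    then have "diameter (W w ` F) \<le> d + 2 * (d / 4)" "d \<le> diameter (W w ` F) + 2 * (d / 4)"
      unfolding d_def[symmetric] using close'[OF w] h
        diameter_W_perturb[of w h "d / 4"] diameter_W_perturb[of h w "d / 4"]
      by (auto simp: d_def norm_minus_commute)
    moreover have "W w z \<in> W w ` F \<inter> cball (W h z) (3 / 2 * d)"
      using close'[OF w z] z \<open>0 < d\<close> by (simp add: dist_norm norm_minus_commute)
    ultimately show "3 / 2 * d / 3 \<le> diameter (W w ` F) \<and> diameter (W w ` F) \<le> 3 / 2 * d \<and>
        W w ` F \<inter> cball (W h z) (3 / 2 * d) \<noteq> {}" by auto
  qed (use A z h W_F \<open>0 < d\<close> in auto)
  then show False using A by simp
qed

end

section \<open>From the definition of a self-conformal set to uniform constants\<close>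

lemma ex_uniform_lower_bound:
  fixes f :: "nat \<Rightarrow> real"
  assumes "\<And>i. i \<in> {1..N::nat} \<Longrightarrow> 0 < f i"
  shows "\<exists>m>0. \<forall>i\<in>{1..N}. m \<le> f i"
proof (cases "N = 0")
  case False
  then show ?thesis using assms by (intro exI[of _ "Min (f ` {1..N})"]) auto
qed (auto intro: zero_less_one)

lemma self_conformal_set_imp_conformal_attractor:
  fixes \<phi> :: "nat \<Rightarrow> 'a::euclidean_space \<Rightarrow> 'a"
  assumes "self_conformal_set N \<phi> \<Omega> F" "\<exists>x\<in>F. \<exists>y\<in>F. x \<noteq> y"
  shows "\<exists>D \<alpha> c m lam. conformal_attractor N \<phi> \<Omega> F D \<alpha> c m lam"
proof -
  have "2 \<le> N" and dom: "bounded \<Omega>" "open \<Omega>" "convex \<Omega>"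
    and F: "F \<noteq> {}" "compact F" "F \<subseteq> \<Omega>" "F = (\<Union>i\<in>{1..N}. \<phi> i ` F)"
    and ifs: "\<And>i. i \<in> {1..N} \<Longrightarrow> conformal_on (\<phi> i) \<Omega> \<and> inj_on (\<phi> i) \<Omega> \<and>
        closure (\<phi> i ` \<Omega>) \<subseteq> \<Omega> \<and> deriv_sup_norm \<Omega> (\<phi> i) < 1"
    using assms(1) unfolding self_conformal_set_def conformal_ifs_def by blast+
  obtain D a b where
    deriv: "\<And>i x. i \<in> {1..N} \<Longrightarrow> x \<in> \<Omega> \<Longrightarrow> (\<phi> i has_derivative blinfun_apply (D i x)) (at x)" and
    cont: "\<And>i. i \<in> {1..N} \<Longrightarrow> continuous_on \<Omega> (D i)" and
    conf: "\<And>i x y. i \<in> {1..N} \<Longrightarrow> x \<in> \<Omega> \<Longrightarrow> y \<noteq> 0 \<Longrightarrow>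
      norm (blinfun_apply (D i x) y) = norm (D i x) * norm y \<and> norm (D i x) * norm y \<noteq> 0" and
    ab: "\<And>i. i \<in> {1..N} \<Longrightarrow> 0 < a i" "\<And>i. i \<in> {1..N} \<Longrightarrow> 0 < b i" and
    holder: "\<And>i x y. i \<in> {1..N} \<Longrightarrow> x \<in> \<Omega> \<Longrightarrow> y \<in> \<Omega> \<Longrightarrow> norm (D i x - D i y) \<le> b i * norm (x - y) powr a i"
  proof -
    define Q where "Q i D a b \<longleftrightarrow> (\<forall>x\<in>\<Omega>. (\<phi> i has_derivative blinfun_apply (D x)) (at x)) \<and>
        continuous_on \<Omega> D \<and>
        (\<forall>x\<in>\<Omega>. \<forall>y. y \<noteq> 0 \<longrightarrow>
           norm (blinfun_apply (D x) y) = norm (D x) * norm y \<and> norm (D x) * norm y \<noteq> 0) \<and>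
        0 < a \<and> 0 < b \<and> (\<forall>x\<in>\<Omega>. \<forall>y\<in>\<Omega>. norm (D x - D y) \<le> b * norm (x - y) powr a)"
      for i and D :: "'a \<Rightarrow> 'a \<Rightarrow>\<^sub>L 'a" and a b
    have "\<exists>D a b. Q i D a b" if "i \<in> {1..N}" for i
    proof -
      have "conformal_on (\<phi> i) \<Omega>" using ifs[OF that] by blast
      then show ?thesis unfolding conformal_on_def Q_def by (elim exE conjE) (intro exI conjI)
    qed
    then obtain D a b where Q: "\<And>i. i \<in> {1..N} \<Longrightarrow> Q i (D i) (a i) (b i)" by metis
    show thesis using Q by (intro that[of D a b]) (simp_all add: Q_def)
  qed
  obtain z where z: "z \<in> F" "z \<in> \<Omega>" using F by blast
  \<comment> \<open>Of two distinct points one is nonzero; testing conformality on it shows that the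
    derivative norm is positive.\<close>
  obtain e :: 'a where e: "e \<noteq> 0" using assms(2) by metis
  have D_pos: "0 < norm (D i x)" if "i \<in> {1..N}" "x \<in> \<Omega>" for i x
    using conf[OF that e] by auto

  \<comment> \<open>With \<open>R \<ge> 1\<close>, lowering the exponent from \<open>a i\<close> to
    \<alpha> costs at most the factor \<open>R powr a i\<close>.\<close>
  define R where "R = max 1 (diameter \<Omega>)"
  have R: "1 \<le> R" "\<And>x y. x \<in> \<Omega> \<Longrightarrow> y \<in> \<Omega> \<Longrightarrow> norm (x - y) \<le> R"
    using diameter_bounded_bound[OF dom(1)] by (auto simp: R_def dist_norm le_max_iff_disj)
  obtain \<alpha> where \<alpha>: "0 < \<alpha>" "\<And>i. i \<in> {1..N} \<Longrightarrow> \<alpha> \<le> a i"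
    using ex_uniform_lower_bound[of N a] ab by blast
  define c where "c = (\<Sum>i\<in>{1..N}. b i * R powr a i)"
  have c_ge: "b i * R powr a i \<le> c" if "i \<in> {1..N}" for i
    unfolding c_def using that less_imp_le[OF ab(2)]
    by (intro member_le_sum) (auto intro!: mult_nonneg_nonneg)
  have c_pos: "0 < c"
  proof (rule less_le_trans)
    show "0 < b 1 * R powr a 1" using ab(2)[of 1] R(1) \<open>2 \<le> N\<close> by simp
    show "b 1 * R powr a 1 \<le> c" using c_ge[of 1] \<open>2 \<le> N\<close> by simp
  qed
  have D_holder: "norm (D i x - D i y) \<le> c * norm (x - y) powr \<alpha>"
    if i: "i \<in> {1..N}" and xy: "x \<in> \<Omega>" "y \<in> \<Omega>" for i x y
  proof -
    have "norm (x - y) powr a i = norm (x - y) powr (a i - \<alpha>) * norm (x - y) powr \<alpha>"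
      by (simp flip: powr_add)
    also have "\<dots> \<le> R powr (a i - \<alpha>) * norm (x - y) powr \<alpha>"
      using R xy \<alpha>(2)[OF i] by (intro mult_right_mono powr_mono2) auto
    also have "\<dots> \<le> R powr a i * norm (x - y) powr \<alpha>"
      using R(1) \<alpha>(1) by (intro mult_right_mono powr_mono) auto
    finally have "b i * norm (x - y) powr a i \<le> b i * (R powr a i * norm (x - y) powr \<alpha>)"
      using less_imp_le[OF ab(2)[OF i]] by (rule mult_left_mono)
    also have "\<dots> \<le> c * norm (x - y) powr \<alpha>"
      using mult_right_mono[OF c_ge[OF i], of "norm (x - y) powr \<alpha>"] by (simp add: mult_ac)
    finally show ?thesis using holder[OF i xy] by simp
  qed

  have "0 < Inf ((\<lambda>x. norm (D i x)) ` F) \<and> (\<forall>x\<in>F. Inf ((\<lambda>x. norm (D i x)) ` F) \<le> norm (D i x))"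
    if i: "i \<in> {1..N}" for i
  proof -
    have "continuous_on F (\<lambda>x. norm (D i x))"
      using continuous_on_subset[OF cont[OF i] F(3)] by (intro continuous_intros)
    then obtain x where x: "x \<in> F" "\<And>y. y \<in> F \<Longrightarrow> norm (D i x) \<le> norm (D i y)"
      using continuous_attains_inf[OF F(2,1)] by blast
    then have "Inf ((\<lambda>x. norm (D i x)) ` F) = norm (D i x)"
      by (intro cInf_eq_minimum) auto
    then show ?thesis using x D_pos[OF i] F(3) by auto
  qed
  then obtain m where m: "0 < m" "\<And>i x. i \<in> {1..N} \<Longrightarrow> x \<in> F \<Longrightarrow> m \<le> norm (D i x)"
    using ex_uniform_lower_bound[of N "\<lambda>i. Inf ((\<lambda>x. norm (D i x)) ` F)"] by (meson order_trans)

  have le_sup: "norm (D i x) \<le> deriv_sup_norm \<Omega> (\<phi> i)" if i: "i \<in> {1..N}" and x: "x \<in> \<Omega>" for i x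
  proof -
    have eq: "deriv_sup_norm \<Omega> (\<phi> i) = (SUP x\<in>\<Omega>. norm (D i x))"
      unfolding deriv_sup_norm_def norm_blinfun.rep_eq
      by (intro SUP_cong refl) (metis deriv[OF i] frechet_derivative_at)
    \<comment> \<open>Hoelder continuity on a bounded set bounds the derivative, so the real
      supremum is a genuine upper bound.\<close>
    have "norm (D i y) \<le> norm (D i z) + c * R powr \<alpha>" if y: "y \<in> \<Omega>" for y
    proof -
      have "norm (D i y) \<le> norm (D i z) + norm (D i y - D i z)" by (rule norm_triangle_sub)
      also have "norm (D i y - D i z) \<le> c * norm (y - z) powr \<alpha>" by (rule D_holder[OF i y z(2)])
      also have "\<dots> \<le> c * R powr \<alpha>"
        using c_pos R(2)[OF y z(2)] \<alpha>(1) by (intro mult_left_mono powr_mono2) auto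
      finally show ?thesis by simp
    qed
    then have "bdd_above ((\<lambda>x. norm (D i x)) ` \<Omega>)" by (rule bdd_aboveI2)
    then show ?thesis unfolding eq using x by (rule cSUP_upper2) simp
  qed
  \<comment> \<open>Finitely many suprema below 1 leave a common gap, which gives the contraction
    ratio \<open>1 - l\<close>.\<close>
  obtain l where l: "0 < l" "\<And>i. i \<in> {1..N} \<Longrightarrow> l \<le> 1 - deriv_sup_norm \<Omega> (\<phi> i)"
    using ex_uniform_lower_bound[of N "\<lambda>i. 1 - deriv_sup_norm \<Omega> (\<phi> i)"] ifs by auto
  have D_upper: "norm (D i x) \<le> 1 - l" if "i \<in> {1..N}" "x \<in> \<Omega>" for i x
    using le_sup[OF that] l(2)[OF that(1)] by simp
  have "0 < 1 - l"
    using \<open>2 \<le> N\<close> z by (intro less_le_trans[OF D_pos[of 1 z] D_upper[of 1 z]]) auto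
  have conf': "norm (D i x y) = norm (D i x) * norm y" if "i \<in> {1..N}" "x \<in> \<Omega>" for i x y
    using conf[OF that, of y] by (cases "y = 0") auto
  have phi_dom: "\<phi> i x \<in> \<Omega>" if "i \<in> {1..N}" "x \<in> \<Omega>" for i x
    using ifs[OF that(1)] that(2) closure_subset[of "\<phi> i ` \<Omega>"] by blast
  have inj: "inj_on (\<phi> i) \<Omega>" if "i \<in> {1..N}" for i
    using ifs[OF that] by blast
  have "1 - l < 1" using l(1) by simp
  have "conformal_attractor N \<phi> \<Omega> F D \<alpha> c m (1 - l)"
    by unfold_locales (fact dom F assms(2) inj phi_dom deriv conf' m D_upper D_holder \<alpha> c_pos
      \<open>0 < 1 - l\<close> \<open>1 - l < 1\<close>)+
  then show ?thesis by blast
qed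

theorem theorem3p2:
  fixes \<phi> :: "nat \<Rightarrow> real ^ 'd \<Rightarrow> real ^ 'd" and \<Omega> F :: "(real ^ 'd) set" and N :: nat
  assumes "self_conformal_set N \<phi> \<Omega> F"
    and "\<exists>x\<in>F. \<exists>y\<in>F. x \<noteq> y"
  shows "weak_separation_condition N \<phi> F \<longleftrightarrow> identity_limit_criterion N \<phi> \<Omega> F"
proof -
  obtain D \<alpha> c m lam where "conformal_attractor N \<phi> \<Omega> F D \<alpha> c m lam"
    using self_conformal_set_imp_conformal_attractor[OF assms] by blast
  then interpret conformal_attractor N \<phi> \<Omega> F D \<alpha> c m lam .
  show ?thesis using wsc_imp_ilc ilc_imp_wsc by blast
qed

end
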